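(* For primes $p\equiv5\pmod{12}$, let $g_{p^3}$ be the genus of $X_0(p^3)$ and let $V_0,V_\infty$ be the vertical $\mathbb{Q}$-divisors on the minimal regular model $\mathcal{X}_0(p^3)$ over $\mathbb{Z}$ given explicitly in the context. Then $$\frac{1}{g_{p^3}-1}\left(g_{p^3}\langle V_0,V_\infty\rangle-\frac{V_0^2+V_\infty^2}{2}\right)=3\,g_{p^3}\log(p)+o\big(g_{p^3}\log p\big)\quad\text{as }p\to\infty,$$ with $p$ running over primes $\equiv5\pmod{12}$.
   Context: For $p\equiv5\pmod{12}$ one has $g_{p^3}=1+\frac{p(p+4)(p-3)-6}{12}$. $\mathcal{X}_0(p^3)$ is the minimal regular model of $X_0(p^3)$ over $\mathbb{Z}$ (it is Edixhoven's regular model). Its fibre over $\mathbb{F}_p$ has components $C_{3,0},C_{0,3},C_{2,1},C_{1,2}$ ($C_{a,b}$ being the reduced Katz–Mazur $(a,b)$-component) and exceptional components $E_1,E_2$ (over $j=1728$) and $F_1,F_2$ (over $j=0$). Their intersection matrix, in the order $C_{3,0},C_{0,3},C_{2,1},C_{1,2},E_1,E_2,F_1,F_2$, is $$\begin{pmatrix} -\frac{p^3-p^2+8}{12} & \frac{p-5}{12} & \frac{p^2-p-8}{12} & \frac{p-5}{12} & 0&0&1&0\\ \frac{p-5}{12} & -\frac{p^3-p^2+8}{12} & \frac{p-5}{12} & \frac{p^2-p-8}{12} & 0&0&0&1\\ \frac{p^2-p-8}{12} & \frac{p-5}{12} & -\frac{p+7}{6} & \frac{p-5}{12} & 1&0&1&0\\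 \frac{p-5}{12} & \frac{p^2-p-8}{12} & \frac{p-5}{12} & -\frac{p+7}{6} & 0&1&0&1\\ 0&0&1&0&-2&0&0&0\\ 0&0&0&1&0&-2&0&0\\ 1&0&1&0&0&0&-2&1\\ 0&1&0&1&0&0&1&-2 \end{pmatrix}.$$ For vertical divisors over $p$, the Arakelov pairing is $\langle V,W\rangle=(V\cdot W)\log p$ with $V\cdot W$ the usual intersection number, and $V^2=\langle V,V\rangle$. The divisors are $V_0=x_1C_{3,0}+x_2C_{0,3}+x_3C_{2,1}+x_4C_{1,2}+x_5E_1+x_6E_2+x_7F_1+x_8F_2$ and $V_\infty=x_1'C_{3,0}+x_2'C_{0,3}+x_3'C_{2,1}+x_4'C_{1,2}+x_5'E_1+x_6'E_2+x_7'F_1+x_8'F_2$ with $x_1=\frac{\frac53p^4-\frac23p^3-\frac{25}{3}p^2-16p+2}{p^4-p^2}$, $x_2=\frac{-\frac43p^4-\frac83p^3+\frac{86}{3}p^2-10p-4}{p^4-p^2}$, $x_3=\frac{\frac23p^4+\frac13p^3-\frac{19}{3}p^2-10p+2}{p^3+p^2}$, $x_4=\frac{-\frac13p^4+\frac13p^3+\frac{20}{3}p^2-16p-4}{p^3+p^2}$, $x_5=\frac{\frac13p^4+\frac16p^3-\frac{19}{6}p^2-5p+1}{p^3+p^2}$, $x_6=\frac{-\frac16p^4+\frac16p^3+\frac{10}{3}p^2-8p-2}{p^3+p^2}$, $x_7=\frac{\frac13p^3+\frac13p^2-4p-2}{p^2-p}$, $x_8=0$; $x_1'=\frac{-\frac53p^4-\frac{10}{3}p^3+\frac{97}{3}p^2-4p-2}{p^4-p^2}$,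 $x_2'=\frac{\frac43p^4-\frac43p^3-\frac{14}{3}p^2-10p+4}{p^4-p^2}$, $x_3'=\frac{-\frac23p^4-\frac13p^3+\frac{31}{3}p^2-10p-2}{p^3+p^2}$, $x_4'=\frac{\frac13p^4-\frac13p^3-\frac83p^2-4p+4}{p^3+p^2}$, $x_5'=\frac{-\frac13p^4-\frac16p^3+\frac{31}{6}p^2-5p-1}{p^3+p^2}$, $x_6'=\frac{\frac16p^4-\frac16p^3-\frac43p^2-2p+2}{p^3+p^2}$, $x_7'=\frac{-\frac13p^3-\frac13p^2+4p+2}{p^2-p}$, $x_8'=0$. (They are chosen so that, for $m\in\{0,\infty\}$, $K-(2g_{p^3}-2)H_m+V_m$ is orthogonal to all vertical divisors, where $K$ is a canonical divisor of $\mathcal{X}_0(p^3)$ and $H_0,H_\infty$ are the sections given by the cusps $0,\infty$, meeting $C_{0,3}$ and $C_{3,0}$ respectively.) *)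

theory Defs
  imports
    "HOL-Analysis.Analysis"
    "HOL-Library.Landau_Symbols"
    "HOL-Number_Theory.Cong"
begin

subsection \<open>The genus of the modular curve $X_0(N)$\<close>

definition SL2Z :: "(int^2^2) set" where
  "SL2Z = {A. det A = 1}"

definition Gamma0 :: "nat \<Rightarrow> (int^2^2) set" where
  "Gamma0 N = {A \<in> SL2Z. int N dvd A $ 2 $ 1}"

text \<open>
  Moebius action on the Riemann sphere, modelled as \<^typ>\<open>complex option\<close> with \<^term>\<open>None\<close> for
  the point at infinity.  The extended upper half plane is stable under \<^const>\<open>SL2Z\<close>.
\<close>

definition moebius_act :: "int^2^2 \<Rightarrow> complex option \<Rightarrow> complex option" where
  "moebius_act A x =
     (case x of
        Some z \<Rightarrow>
          (if of_int (A $ 2 $ 1) * z + of_int (A $ 2 $ 2) = 0 then None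
           else Some ((of_int (A $ 1 $ 1) * z + of_int (A $ 1 $ 2)) /
                      (of_int (A $ 2 $ 1) * z + of_int (A $ 2 $ 2))))
      | None \<Rightarrow>
          (if A $ 2 $ 1 = 0 then None
           else Some (of_int (A $ 1 $ 1) / of_int (A $ 2 $ 1))))"

text \<open>
  Complex points of $X_0(N)$ are \<^term>\<open>Gamma0 N\<close>-orbits on the extended upper half plane, and those of
  $X(1)$ are \<^const>\<open>SL2Z\<close>-orbits.  The fibre of $X_0(N) \to X(1)$ over the class of \<open>x\<close> thus consists
  of the \<^term>\<open>Gamma0 N\<close>-orbits inside the \<^const>\<open>SL2Z\<close>-orbit of \<open>x\<close>.
\<close>

definition X0_point :: "nat \<Rightarrow> complex option \<Rightarrow> complex option set" where
  "X0_point N y = (\<lambda>A. moebius_act A y) ` Gamma0 N"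

definition X0_fibre :: "nat \<Rightarrow> complex option \<Rightarrow> complex option set set" where
  "X0_fibre N x = (\<lambda>A. X0_point N (moebius_act A x)) ` SL2Z"

text \<open>
  The degree of $X_0(N) \to X(1)$ is the index of \<^term>\<open>Gamma0 N\<close> in \<^const>\<open>SL2Z\<close> (both groups
  contain $-1$), i.e. the number of cosets \<open>Gamma0 N ** B\<close>.
\<close>

definition X0_degree :: "nat \<Rightarrow> nat" where
  "X0_degree N = card ((\<lambda>B. (\<lambda>A. A ** B) ` Gamma0 N) ` SL2Z)"

text \<open>
  The genus is given by the Riemann-Hurwitz formula for $X_0(N) \to X(1) \cong \mathbb{P}^1$, a
  covering of degree $d$ which is unramified away from $j = 1728$ (the class of $i$), $j = 0$ (the
  class of $e^{i\pi/3}$) and $j = \infty$: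
  \[ 2g - 2 = -2d + (d - n_{1728}) + (d - n_0) + (d - n_\infty), \]
  where $n_x$ is the number of points over $x$.  It is taken as a real number only in order to
  avoid truncating operations.
\<close>

definition genus_X0 :: "nat \<Rightarrow> real" where
  "genus_X0 N =
     1 + (- 2 * real (X0_degree N)
          + (real (X0_degree N) - real (card (X0_fibre N (Some \<i>))))
          + (real (X0_degree N) - real (card (X0_fibre N (Some (cis (pi / 3))))))
          + (real (X0_degree N) - real (card (X0_fibre N None)))) / 2"


subsection \<open>Vertical divisors on the minimal regular model of $X_0(p^3)$\<close>

text \<open>
  The components of the fibre over $\mathbb{F}_p$, for $p \equiv 5 \pmod{12}$: \<open>Cab\<close> is the reduced
  Katz-Mazur $(a,b)$-component, \<open>E1, E2\<close> are the exceptional components over $j = 1728$ and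
  \<open>F1, F2\<close> those over $j = 0$.
\<close>

datatype component = C30 | C03 | C21 | C12 | E1 | E2 | F1 | F2

lemma UNIV_component: "(UNIV :: component set) = {C30, C03, C21, C12, E1, E2, F1, F2}"
proof -
  have "x \<in> {C30, C03, C21, C12, E1, E2, F1, F2}" for x :: component
    by (cases x) simp_all
  then show ?thesis by blast
qed

instance component :: finite
  by standard (simp add: UNIV_component)

text \<open>
  A vertical $\mathbb{Q}$-divisor over $p$ is a formal rational combination of the components; it is
  represented by its coefficient function.
\<close>

type_synonym vertical_divisor = "component \<Rightarrow> rat"

text \<open>
  Intersection matrix.  The arguments of \<^const>\<open>case_component\<close> are the entries of a row, in the
  order \<open>C30, C03, C21, C12, E1, E2, F1, F2\<close>.
\<close>

primrec component_intersection :: "rat \<Rightarrow> component \<Rightarrow> component \<Rightarrow> rat" where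
  "component_intersection p C30 = case_component
     (- ((p^3 - p^2 + 8) / 12)) ((p - 5) / 12) ((p^2 - p - 8) / 12) ((p - 5) / 12) 0 0 1 0"
| "component_intersection p C03 = case_component
     ((p - 5) / 12) (- ((p^3 - p^2 + 8) / 12)) ((p - 5) / 12) ((p^2 - p - 8) / 12) 0 0 0 1"
| "component_intersection p C21 = case_component
     ((p^2 - p - 8) / 12) ((p - 5) / 12) (- ((p + 7) / 6)) ((p - 5) / 12) 1 0 1 0"
| "component_intersection p C12 = case_component
     ((p - 5) / 12) ((p^2 - p - 8) / 12) ((p - 5) / 12) (- ((p + 7) / 6)) 0 1 0 1"
| "component_intersection p E1 = case_component 0 0 1 0 (-2) 0 0 0"
| "component_intersection p E2 = case_component 0 0 0 1 0 (-2) 0 0"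
| "component_intersection p F1 = case_component 1 0 1 0 0 0 (-2) 1"
| "component_intersection p F2 = case_component 0 1 0 1 0 0 1 (-2)"

definition intersection_number :: "nat \<Rightarrow> vertical_divisor \<Rightarrow> vertical_divisor \<Rightarrow> rat" where
  "intersection_number p V W =
     (\<Sum>C\<in>UNIV. \<Sum>D\<in>UNIV. V C * W D * component_intersection (of_nat p) C D)"

definition arakelov_pairing :: "nat \<Rightarrow> vertical_divisor \<Rightarrow> vertical_divisor \<Rightarrow> real" where
  "arakelov_pairing p V W = of_rat (intersection_number p V W) * ln (real p)"

primrec V0_coeff :: "rat \<Rightarrow> vertical_divisor" where
  "V0_coeff p C30 = (5/3 * p^4 - 2/3 * p^3 - 25/3 * p^2 - 16 * p + 2) / (p^4 - p^2)"
| "V0_coeff p C03 = (- (4/3) * p^4 - 8/3 * p^3 + 86/3 * p^2 - 10 * p - 4) / (p^4 - p^2)"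
| "V0_coeff p C21 = (2/3 * p^4 + 1/3 * p^3 - 19/3 * p^2 - 10 * p + 2) / (p^3 + p^2)"
| "V0_coeff p C12 = (- (1/3) * p^4 + 1/3 * p^3 + 20/3 * p^2 - 16 * p - 4) / (p^3 + p^2)"
| "V0_coeff p E1 = (1/3 * p^4 + 1/6 * p^3 - 19/6 * p^2 - 5 * p + 1) / (p^3 + p^2)"
| "V0_coeff p E2 = (- (1/6) * p^4 + 1/6 * p^3 + 10/3 * p^2 - 8 * p - 2) / (p^3 + p^2)"
| "V0_coeff p F1 = (1/3 * p^3 + 1/3 * p^2 - 4 * p - 2) / (p^2 - p)"
| "V0_coeff p F2 = 0"

primrec Vinf_coeff :: "rat \<Rightarrow> vertical_divisor" where
  "Vinf_coeff p C30 = (- (5/3) * p^4 - 10/3 * p^3 + 97/3 * p^2 - 4 * p - 2) / (p^4 - p^2)"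
| "Vinf_coeff p C03 = (4/3 * p^4 - 4/3 * p^3 - 14/3 * p^2 - 10 * p + 4) / (p^4 - p^2)"
| "Vinf_coeff p C21 = (- (2/3) * p^4 - 1/3 * p^3 + 31/3 * p^2 - 10 * p - 2) / (p^3 + p^2)"
| "Vinf_coeff p C12 = (1/3 * p^4 - 1/3 * p^3 - 8/3 * p^2 - 4 * p + 4) / (p^3 + p^2)"
| "Vinf_coeff p E1 = (- (1/3) * p^4 - 1/6 * p^3 + 31/6 * p^2 - 5 * p - 1) / (p^3 + p^2)"
| "Vinf_coeff p E2 = (1/6 * p^4 - 1/6 * p^3 - 4/3 * p^2 - 2 * p + 2) / (p^3 + p^2)"
| "Vinf_coeff p F1 = (- (1/3) * p^3 - 1/3 * p^2 + 4 * p + 2) / (p^2 - p)"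
| "Vinf_coeff p F2 = 0"

definition V0 :: "nat \<Rightarrow> vertical_divisor" where
  "V0 p = V0_coeff (of_nat p)"

definition Vinf :: "nat \<Rightarrow> vertical_divisor" where
  "Vinf p = Vinf_coeff (of_nat p)"

text \<open>
  The limit $p \to \infty$ along primes $p \equiv 5 \pmod{12}$.
\<close>

definition primes_5_mod_12 :: "nat filter" where
  "primes_5_mod_12 = inf at_top (principal {p. prime p \<and> [p = 5] (mod 12)})"

end

theory Submission
  imports Defs "HOL-Real_Asymp.Real_Asymp"
begin

text \<open>
  Both sides are multiples of $\log p$, so the claim concerns the growth of the genus $g$ of
  $X_0(p^3)$ and of the rational numbers $V_0 \cdot V_\infty$, $V_0^2$ and $V_\infty^2$.  Now
  $g \sim p^3/12$, $V_0 \cdot V_\infty \sim p^3/4$ and $V_0^2 = V_\infty^2 \sim -p^3/4$.  Hence the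
  self-intersections, divided by $g - 1$, stay bounded and are absorbed by the error term, whereas
  $\frac{g}{g-1} V_0 \cdot V_\infty \sim p^3/4 \sim 3 g$.

  The asymptotics of the genus (\<open>genus_X0_prime_cube_bounds\<close>) comes from counting points on
  $\mathbb{P}^1(\mathbb{Z}/p^3)$, which parametrises the cosets of $\Gamma_0(p^3)$ by bottom rows:
  the degree is the number of points and each fibre is the set of orbits of a stabiliser
  (\<open>X0_point_eq_iff\<close>).  Only the affine points $(1 : t)$ matter, as there are $p^3$ of them and only
  $p^2$ others.  On these the stabiliser of $\infty$ has a single orbit, the one of $i$ acts through an
  involution and the one of $e^{i \pi / 3}$ through a group of order three, with at most $4 p^2$ points
  whose orbit is not of full size.  So $2 g - 2 = p^3 (1 - \frac12 - \frac13) + O(p^2)$.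

  For the intersection numbers, the products of $V_0$ with the components are simple polynomials
  prescribed by adjunction (\<open>V0_dot_component\<close>).  The Atkin-Lehner involution carries $V_0$ to
  $V_\infty$ up to a multiple of the fibre (\<open>Vinf_coeff_eq\<close>).  This yields
  $V_\infty^2 = V_0^2$, and both remaining numbers become explicit rational functions of $p$.
\<close>

section \<open>The Moebius action is a group action\<close>

text \<open>
  Homogeneous coordinates on the Riemann sphere.  In them the Moebius action is linear, so the
  composition law needs no case distinction on poles and on the point at infinity.
\<close>

definition proj_point :: "complex \<Rightarrow> complex \<Rightarrow> complex option" where
  "proj_point u v = (if v = 0 then None else Some (u / v))"

definition mat2 :: "int \<Rightarrow> int \<Rightarrow> int \<Rightarrow> int \<Rightarrow> int^2^2" where
  "mat2 a b c d = vector [vector [a, b], vector [c, d]]"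

lemma mat2_entries [simp]:
  "mat2 a b c d $ 1 $ 1 = a" "mat2 a b c d $ 1 $ 2 = b" "mat2 a b c d $ 2 $ 1 = c" "mat2 a b c d $ 2 $ 2 = d"
  by (simp_all add: mat2_def)

lemma matrix2_eq_iff:
  fixes A B :: "int^2^2"
  shows "A = B \<longleftrightarrow> A $ 1 $ 1 = B $ 1 $ 1 \<and> A $ 1 $ 2 = B $ 1 $ 2 \<and> A $ 2 $ 1 = B $ 2 $ 1 \<and> A $ 2 $ 2 = B $ 2 $ 2"
  by (auto simp: vec_eq_iff forall_2)

lemma mult_entry:
  fixes A B :: "int^2^2"
  shows "(A ** B) $ i $ j = A $ i $ 1 * B $ 1 $ j + A $ i $ 2 * B $ 2 $ j"
  by (simp add: matrix_matrix_mult_def sum_2)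

definition adjugate :: "int^2^2 \<Rightarrow> int^2^2" where
  "adjugate A = mat2 (A $ 2 $ 2) (- (A $ 1 $ 2)) (- (A $ 2 $ 1)) (A $ 1 $ 1)"

lemma SL2Z_iff: "A \<in> SL2Z \<longleftrightarrow> A $ 1 $ 1 * A $ 2 $ 2 - A $ 1 $ 2 * A $ 2 $ 1 = 1"
  by (simp add: SL2Z_def det_2)

lemma SL2Z_mult: "A \<in> SL2Z \<Longrightarrow> B \<in> SL2Z \<Longrightarrow> A ** B \<in> SL2Z"
  by (simp add: SL2Z_def det_mul)

lemma SL2Z_adjugate: "A \<in> SL2Z \<Longrightarrow> adjugate A \<in> SL2Z"
  by (simp add: SL2Z_iff adjugate_def algebra_simps)

lemma mult_adjugate: "A \<in> SL2Z \<Longrightarrow> A ** adjugate A = mat 1"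
  and adjugate_mult: "A \<in> SL2Z \<Longrightarrow> adjugate A ** A = mat 1"
  by (auto simp: SL2Z_iff matrix2_eq_iff mult_entry adjugate_def mat_def algebra_simps)

lemma moebius_act_proj_point:
  assumes "A \<in> SL2Z" "u \<noteq> 0 \<or> v \<noteq> 0"
  shows "moebius_act A (proj_point u v) =
    proj_point (of_int (A $ 1 $ 1) * u + of_int (A $ 1 $ 2) * v) (of_int (A $ 2 $ 1) * u + of_int (A $ 2 $ 2) * v)"
proof (cases "v = 0")
  case True
  then show ?thesis using assms by (auto simp: moebius_act_def proj_point_def)
next
  case False
  have "of_int (A $ 2 $ 1) * (u / v) + of_int (A $ 2 $ 2) = (of_int (A $ 2 $ 1) * u + of_int (A $ 2 $ 2) * v) / v"
       "of_int (A $ 1 $ 1) * (u / v) + of_int (A $ 1 $ 2) = (of_int (A $ 1 $ 1) * u + of_int (A $ 1 $ 2) * v) / v"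
    using False by (simp_all add: field_simps)
  then show ?thesis using False by (simp add: moebius_act_def proj_point_def)
qed

lemma proj_point_cases:
  obtains u v where "x = proj_point u v" "u \<noteq> 0 \<or> v \<noteq> 0"
proof (cases x)
  case None
  then have "x = proj_point 1 0" by (simp add: proj_point_def)
  then show ?thesis using that[of 1 0] by simp
next
  case (Some z)
  then have "x = proj_point z 1" by (simp add: proj_point_def)
  then show ?thesis using that[of z 1] by simp
qed

lemma moebius_act_mult:
  assumes A: "A \<in> SL2Z" and B: "B \<in> SL2Z"
  shows "moebius_act (A ** B) x = moebius_act A (moebius_act B x)"
proof -
  obtain u v where x: "x = proj_point u v" and uv: "u \<noteq> 0 \<or> v \<noteq> 0" by (rule proj_point_cases)
  define u' v' where "u' = of_int (B $ 1 $ 1) * u + of_int (B $ 1 $ 2) * v"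
    and "v' = of_int (B $ 2 $ 1) * u + of_int (B $ 2 $ 2) * v"
  have "of_int (B $ 1 $ 1 * B $ 2 $ 2 - B $ 1 $ 2 * B $ 2 $ 1) = (1 :: complex)"
    using B by (simp only: SL2Z_iff) simp
  then have det: "of_int (B $ 1 $ 1) * of_int (B $ 2 $ 2) - of_int (B $ 1 $ 2) * of_int (B $ 2 $ 1) = (1 :: complex)"
    by simp
  have "u = of_int (B $ 2 $ 2) * u' - of_int (B $ 1 $ 2) * v'"
       "v = of_int (B $ 1 $ 1) * v' - of_int (B $ 2 $ 1) * u'"
    unfolding u'_def v'_def using det by algebra+
  then have "u' \<noteq> 0 \<or> v' \<noteq> 0" using uv by auto
  then show ?thesis
    using moebius_act_proj_point[OF SL2Z_mult[OF A B] uv] moebius_act_proj_point[OF B uv] moebius_act_proj_point[OF A, of u' v']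
    by (simp add: x mult_entry algebra_simps flip: u'_def v'_def) (simp add: u'_def v'_def algebra_simps)
qed

lemma mat1_SL2Z: "mat 1 \<in> SL2Z" by (simp add: SL2Z_iff mat_def)

lemma moebius_act_one: "moebius_act (mat 1) x = x"
  by (auto simp: moebius_act_def mat_def split: option.split)

lemma moebius_act_adjugate:
  assumes "A \<in> SL2Z" shows "moebius_act (adjugate A) (moebius_act A x) = x"
  using moebius_act_mult[OF SL2Z_adjugate[OF assms] assms] by (simp add: adjugate_mult assms moebius_act_one)

section \<open>Cosets of $\Gamma_0(N)$ and points of $X_0(N)$ in terms of bottom rows\<close>

text \<open>
  Equality of the bottom rows as points of $\mathbb{P}^1(\mathbb{Z}/N)$: two primitive rows are
  proportional by a unit modulo $N$ exactly if their determinant vanishes modulo $N$.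
\<close>

definition row_equiv :: "nat \<Rightarrow> int^2^2 \<Rightarrow> int^2^2 \<Rightarrow> bool" where
  "row_equiv N A B \<longleftrightarrow> int N dvd A $ 2 $ 1 * B $ 2 $ 2 - A $ 2 $ 2 * B $ 2 $ 1"

lemma Gamma0_iff: "A \<in> Gamma0 N \<longleftrightarrow> A \<in> SL2Z \<and> int N dvd A $ 2 $ 1"
  by (simp add: Gamma0_def)

lemma Gamma0_mult: "A \<in> Gamma0 N \<Longrightarrow> B \<in> Gamma0 N \<Longrightarrow> A ** B \<in> Gamma0 N"
  by (auto simp: Gamma0_iff SL2Z_mult mult_entry)

lemma Gamma0_adjugate: "A \<in> Gamma0 N \<Longrightarrow> adjugate A \<in> Gamma0 N"
  by (auto simp: Gamma0_iff SL2Z_adjugate) (simp add: adjugate_def)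

lemma mat1_Gamma0: "mat 1 \<in> Gamma0 N" by (simp add: Gamma0_iff mat1_SL2Z) (simp add: mat_def)

text \<open>
  The determinant of the two bottom rows is the lower left entry of $A B^{-1}$, which is the only
  possible $G$ with $A = G B$.
\<close>

lemma row_equiv_iff:
  assumes "A \<in> SL2Z" "B \<in> SL2Z"
  shows "row_equiv N A B \<longleftrightarrow> (\<exists>G\<in>Gamma0 N. A = G ** B)"
proof
  assume r: "row_equiv N A B"
  have "(A ** adjugate B) $ 2 $ 1 = A $ 2 $ 1 * B $ 2 $ 2 - A $ 2 $ 2 * B $ 2 $ 1"
    by (simp add: mult_entry adjugate_def)
  then have "A ** adjugate B \<in> Gamma0 N"
    using r assms by (simp add: Gamma0_iff SL2Z_mult SL2Z_adjugate row_equiv_def)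
  moreover have "A = (A ** adjugate B) ** B"
    by (simp add: adjugate_mult assms flip: matrix_mul_assoc)
  ultimately show "\<exists>G\<in>Gamma0 N. A = G ** B" by blast
next
  assume "\<exists>G\<in>Gamma0 N. A = G ** B"
  then obtain G where G: "G \<in> Gamma0 N" "A = G ** B" by blast
  have "A $ 2 $ 1 * B $ 2 $ 2 - A $ 2 $ 2 * B $ 2 $ 1
     = G $ 2 $ 1 * (B $ 1 $ 1 * B $ 2 $ 2 - B $ 1 $ 2 * B $ 2 $ 1)"
    by (simp add: G(2) mult_entry algebra_simps)
  then show "row_equiv N A B" using G(1) by (simp add: row_equiv_def Gamma0_iff)
qed

lemma coset_eq_iff:
  assumes "A \<in> SL2Z" "B \<in> SL2Z"
  shows "(\<lambda>X. X ** A) ` Gamma0 N = (\<lambda>X. X ** B) ` Gamma0 N \<longleftrightarrow> row_equiv N A B"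
proof
  assume eq: "(\<lambda>X. X ** A) ` Gamma0 N = (\<lambda>X. X ** B) ` Gamma0 N"
  have "mat 1 ** A \<in> (\<lambda>X. X ** A) ` Gamma0 N" using mat1_Gamma0 by blast
  then have "A \<in> (\<lambda>X. X ** B) ` Gamma0 N" by (simp add: eq)
  then show "row_equiv N A B" using row_equiv_iff[OF assms] by blast
next
  assume "row_equiv N A B"
  then obtain G where G: "G \<in> Gamma0 N" "A = G ** B" using row_equiv_iff[OF assms] by blast
  have "B = adjugate G ** A"
    using G adjugate_mult[of G] by (simp add: matrix_mul_assoc Gamma0_iff)
  then show "(\<lambda>X. X ** A) ` Gamma0 N = (\<lambda>X. X ** B) ` Gamma0 N"
    using G Gamma0_mult[OF _ G(1)] Gamma0_mult[OF _ Gamma0_adjugate[OF G(1)]]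
    by (auto simp: image_iff matrix_mul_assoc) (metis matrix_mul_assoc)+
qed

text \<open>
  If $A x$ and $B x$ are related by $G \in \Gamma_0(N)$, then $M = A^{-1} G B$ fixes $x$.  Hence the
  fibre over the class of $x$ is the set of orbits of the stabiliser of $x$ acting from the right on
  $\mathbb{P}^1(\mathbb{Z}/N)$.
\<close>

lemma X0_point_eq_iff:
  assumes A: "A \<in> SL2Z" and B: "B \<in> SL2Z"
  shows "X0_point N (moebius_act A x) = X0_point N (moebius_act B x) \<longleftrightarrow>
         (\<exists>M\<in>SL2Z. moebius_act M x = x \<and> row_equiv N (A ** M) B)"
proof
  assume eq: "X0_point N (moebius_act A x) = X0_point N (moebius_act B x)"
  have "moebius_act A x \<in> X0_point N (moebius_act A x)"
    unfolding X0_point_def using mat1_Gamma0 moebius_act_one by (metis image_eqI)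
  then obtain G where G: "G \<in> Gamma0 N" "moebius_act A x = moebius_act G (moebius_act B x)"
    unfolding eq by (auto simp: X0_point_def)
  define M where "M = adjugate A ** (G ** B)"
  have SL: "G \<in> SL2Z" "G ** B \<in> SL2Z" "adjugate A \<in> SL2Z" using G B A by (auto simp: Gamma0_iff SL2Z_mult SL2Z_adjugate)
  have "M \<in> SL2Z" by (simp add: M_def SL SL2Z_mult)
  moreover have "moebius_act M x = x"
    using SL by (simp add: M_def moebius_act_mult B moebius_act_adjugate[OF A] flip: G(2))
  moreover have "A ** M = G ** B" by (simp add: M_def matrix_mul_assoc mult_adjugate A)
  then have "row_equiv N (A ** M) B"
    using row_equiv_iff[of "A ** M" B N] G(1) SL B by auto
  ultimately show "\<exists>M\<in>SL2Z. moebius_act M x = x \<and> row_equiv N (A ** M) B" by blast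
next
  assume "\<exists>M\<in>SL2Z. moebius_act M x = x \<and> row_equiv N (A ** M) B"
  then obtain M G where M: "M \<in> SL2Z" "moebius_act M x = x" and G: "G \<in> Gamma0 N" "A ** M = G ** B"
    using row_equiv_iff[OF SL2Z_mult[OF A] B] by blast
  have GS: "G \<in> SL2Z" using G by (simp add: Gamma0_iff)
  have "moebius_act A x = moebius_act (A ** M) x" by (simp add: moebius_act_mult A M)
  then have y: "moebius_act A x = moebius_act G (moebius_act B x)" by (simp add: G moebius_act_mult GS B)
  have "moebius_act B x = moebius_act (adjugate G) (moebius_act A x)" by (simp add: y moebius_act_adjugate GS)
  then have 1: "moebius_act X (moebius_act B x) = moebius_act (X ** adjugate G) (moebius_act A x)" if "X \<in> Gamma0 N" for X
    using that by (simp add: moebius_act_mult SL2Z_adjugate GS Gamma0_iff)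
  have 2: "moebius_act X (moebius_act A x) = moebius_act (X ** G) (moebius_act B x)" if "X \<in> Gamma0 N" for X
    using that by (simp add: moebius_act_mult GS y Gamma0_iff)
  show "X0_point N (moebius_act A x) = X0_point N (moebius_act B x)"
    unfolding X0_point_def
    using 1 2 Gamma0_mult[OF _ G(1)] Gamma0_mult[OF _ Gamma0_adjugate[OF G(1)]] by (auto simp: image_iff; metis)
qed

section \<open>The projective line over $\mathbb{Z}/p^3$\<close>

text \<open>
  The points $(1 : t)$ and $(c : 1)$ of the projective line over $\mathbb{Z}/p^3$.  The first kind
  accounts for $p^3$ points, and the second is needed only for $p \mid c$, which leaves $p^2$ points.
  These are negligible against $p^3$, so every count below is done on the affine points alone.
\<close>

definition affine_rep :: "int \<Rightarrow> int^2^2" where "affine_rep t = mat2 0 (-1) 1 t"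
definition residual_rep :: "int \<Rightarrow> int^2^2" where "residual_rep c = mat2 1 0 c 1"

lemma affine_rep_SL2Z: "affine_rep t \<in> SL2Z" by (simp add: affine_rep_def SL2Z_iff)
lemma residual_rep_SL2Z: "residual_rep c \<in> SL2Z" by (simp add: residual_rep_def SL2Z_iff)

lemma row_equiv_affine_rep_iff: "row_equiv N A (affine_rep t) \<longleftrightarrow> int N dvd A $ 2 $ 1 * t - A $ 2 $ 2"
  by (simp add: row_equiv_def affine_rep_def)

lemma row_equiv_residual_rep_iff: "row_equiv N A (residual_rep c) \<longleftrightarrow> int N dvd A $ 2 $ 1 - A $ 2 $ 2 * c"
  by (simp add: row_equiv_def residual_rep_def)

lemma coprime_solve_mod:
  fixes a b n :: int
  assumes "coprime a n" "n > 0"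
  obtains t where "t \<in> {0..<n}" "n dvd a * t - b"
proof -
  obtain y where "[a * y = 1] (mod n)" using cong_solve_coprime_int[OF assms(1)] by blast
  then have "[a * y * b = 1 * b] (mod n)" by (rule cong_mult) simp
  then have "[a * ((y * b) mod n) = b] (mod n)" by (simp add: cong_def mod_mult_right_eq mult.assoc)
  then have "n dvd a * ((y * b) mod n) - b" by (simp add: cong_iff_dvd_diff)
  with assms(2) show ?thesis by (intro that[of "(y * b) mod n"]) auto
qed

lemma coprime_prime_cube:
  assumes "prime p" "\<not> int p dvd a"
  shows "coprime a (int (p ^ 3))"
  using assms by (metis coprime_commute coprime_power_right_iff of_nat_power prime_imp_coprime prime_int_nat_transfer prime_nat_int_transfer)

text \<open>
  In a primitive row one of the entries is a unit modulo $p^3$; dividing by it normalises the row.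
\<close>

lemma row_equiv_representative:
  assumes p: "prime p" and A: "A \<in> SL2Z"
  shows "(\<exists>t\<in>{0..<int p ^ 3}. row_equiv (p^3) A (affine_rep t)) \<or> (\<exists>s\<in>{0..<int p ^ 2}. row_equiv (p^3) A (residual_rep (int p * s)))"
proof (cases "int p dvd A $ 2 $ 1")
  case False
  have "coprime (A $ 2 $ 1) (int p ^ 3)" using coprime_prime_cube[OF p False] by simp
  moreover have "int p ^ 3 > 0" using p by (simp add: prime_gt_0_nat)
  ultimately obtain t where "t \<in> {0..<int p ^ 3}" "int p ^ 3 dvd A $ 2 $ 1 * t - A $ 2 $ 2"
    by (rule coprime_solve_mod)
  then have "row_equiv (p^3) A (affine_rep t)" by (simp add: row_equiv_affine_rep_iff)
  with \<open>t \<in> {0..<int p ^ 3}\<close> show ?thesis by blast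
next
  case True
  have p0: "int p > 0" using p by (simp add: prime_gt_0_nat)
  have "\<not> int p dvd A $ 2 $ 2"
  proof
    assume "int p dvd A $ 2 $ 2"
    then have "int p dvd A $ 1 $ 1 * A $ 2 $ 2 - A $ 1 $ 2 * A $ 2 $ 1" using True by simp
    then show False using A p by (auto simp: SL2Z_iff)
  qed
  then have "coprime (A $ 2 $ 2) (int p ^ 3)" using coprime_prime_cube[OF p] by simp
  then obtain c where c: "c \<in> {0..<int p ^ 3}" "int p ^ 3 dvd A $ 2 $ 2 * c - A $ 2 $ 1"
    using coprime_solve_mod[of "A $ 2 $ 2" "int p ^ 3" "A $ 2 $ 1"] p0 by auto
  have "int p dvd A $ 2 $ 2 * c - A $ 2 $ 1" using c(2) by (rule dvd_trans[rotated]) simp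
  then have "int p dvd A $ 2 $ 2 * c" using True by (simp add: dvd_diff_left_iff)
  then have "int p dvd c" using \<open>\<not> int p dvd A $ 2 $ 2\<close> p by (simp add: prime_dvd_mult_iff)
  then obtain s where s: "c = int p * s" ..
  have "int p * s < int p * int p ^ 2" using c(1) by (simp add: s power_numeral_reduce)
  then have "s \<in> {0..<int p ^ 2}" using c(1) p0 by (auto simp: s zero_le_mult_iff)
  moreover have "row_equiv (p^3) A (residual_rep (int p * s))"
    using c(2) by (simp add: row_equiv_residual_rep_iff s dvd_diff_commute)
  ultimately show ?thesis by blast
qed

text \<open>
  Applied to the coset map and to the map onto a fibre, this reduces both the degree and the number
  of points in a fibre to a count over $0 \le t < p^3$, with an error of at most $p^2$.
\<close>

lemma card_image_SL2Z_bounds: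
  fixes f :: "int^2^2 \<Rightarrow> 'a"
  assumes p: "prime p"
    and inv: "\<And>A B. A \<in> SL2Z \<Longrightarrow> B \<in> SL2Z \<Longrightarrow> row_equiv (p^3) A B \<Longrightarrow> f A = f B"
  shows "card ((\<lambda>t. f (affine_rep t)) ` {0..<int p ^ 3}) \<le> card (f ` SL2Z)"
    and "card (f ` SL2Z) \<le> card ((\<lambda>t. f (affine_rep t)) ` {0..<int p ^ 3}) + p^2"
proof -
  let ?X = "(\<lambda>t. f (affine_rep t)) ` {0..<int p ^ 3}" and ?Y = "(\<lambda>s. f (residual_rep (int p * s))) ` {0..<int p ^ 2}"
  have eq: "f ` SL2Z = ?X \<union> ?Y"
  proof
    show "f ` SL2Z \<subseteq> ?X \<union> ?Y"
      using row_equiv_representative[OF p] inv affine_rep_SL2Z residual_rep_SL2Z by (fastforce simp: image_iff)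
  qed (auto simp: affine_rep_SL2Z residual_rep_SL2Z)
  show "card ?X \<le> card (f ` SL2Z)" unfolding eq by (rule card_mono) auto
  have "card (f ` SL2Z) \<le> card ?X + card ?Y" unfolding eq by (rule card_Un_le)
  moreover have "card ?Y \<le> card {0..<int p ^ 2}" by (rule card_image_le) simp
  then have "card ?Y \<le> p^2" by (simp add: nat_power_eq)
  ultimately show "card (f ` SL2Z) \<le> card ?X + p^2" by simp
qed

lemma X0_degree_bounds:
  assumes p: "prime p"
  shows "p^3 \<le> X0_degree (p^3)" "X0_degree (p^3) \<le> p^3 + p^2"
proof -
  define f where "f B = (\<lambda>A. A ** B) ` Gamma0 (p^3)" for B :: "int^2^2"
  have iff: "f A = f B \<longleftrightarrow> row_equiv (p^3) A B" if "A \<in> SL2Z" "B \<in> SL2Z" for A B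
    unfolding f_def by (rule coset_eq_iff[OF that])
  have "inj_on (\<lambda>t. f (affine_rep t)) {0..<int p ^ 3}"
  proof
    fix s t assume st: "s \<in> {0..<int p ^ 3}" "t \<in> {0..<int p ^ 3}" "f (affine_rep s) = f (affine_rep t)"
    then have "int p ^ 3 dvd t - s" by (simp add: iff affine_rep_SL2Z row_equiv_affine_rep_iff) (simp add: affine_rep_def)
    then have "[t = s] (mod int p ^ 3)" by (simp add: cong_iff_dvd_diff)
    then show "s = t" using st by (simp add: cong_def)
  qed
  then have "card ((\<lambda>t. f (affine_rep t)) ` {0..<int p ^ 3}) = p^3"
    by (simp add: card_image nat_power_eq)
  moreover have "X0_degree (p^3) = card (f ` SL2Z)" by (simp add: X0_degree_def f_def[abs_def])
  ultimately show "p^3 \<le> X0_degree (p^3)" "X0_degree (p^3) \<le> p^3 + p^2"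
    using card_image_SL2Z_bounds[OF p, of f] iff by simp_all
qed

lemma X0_fibre_card_bounds:
  assumes p: "prime p"
  defines "n \<equiv> \<lambda>x. card ((\<lambda>t. X0_point (p^3) (moebius_act (affine_rep t) x)) ` {0..<int p ^ 3})"
  shows "n x \<le> card (X0_fibre (p^3) x)" "card (X0_fibre (p^3) x) \<le> n x + p^2"
proof -
  have "X0_point (p^3) (moebius_act A x) = X0_point (p^3) (moebius_act B x)"
    if "A \<in> SL2Z" "B \<in> SL2Z" "row_equiv (p^3) A B" for A B
  proof -
    have "A ** mat 1 = A" by simp
    then show ?thesis
      using that mat1_SL2Z moebius_act_one[of x] by (subst X0_point_eq_iff) (auto intro!: bexI[of _ "mat 1"])
  qed
  note * = card_image_SL2Z_bounds[OF p, of "\<lambda>A. X0_point (p^3) (moebius_act A x)", OF this]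
  show "n x \<le> card (X0_fibre (p^3) x)" "card (X0_fibre (p^3) x) \<le> n x + p^2"
    using * by (simp_all add: n_def X0_fibre_def)
qed

text \<open>
  All affine representatives send $\infty$ to the same cusp $0$, so only the $p^2$ residual ones can
  contribute further cusps.
\<close>

lemma card_cusps_le:
  assumes p: "prime p"
  shows "card (X0_fibre (p^3) None) \<le> 1 + p^2"
proof -
  have "(\<lambda>t. X0_point (p^3) (moebius_act (affine_rep t) None)) ` {0..<int p ^ 3} \<subseteq> {X0_point (p^3) (Some 0)}"
    by (auto simp: moebius_act_def affine_rep_def)
  then have "card ((\<lambda>t. X0_point (p^3) (moebius_act (affine_rep t) None)) ` {0..<int p ^ 3}) \<le> 1"
    by (metis card_mono finite.emptyI finite.insertI is_singletonI is_singleton_altdef)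
  then show ?thesis using X0_fibre_card_bounds(2)[OF p, of None] by linarith
qed

section \<open>Orbit counting and quadratic congruences\<close>

text \<open>
  Orbit counting in the form of inequalities: if all fibres of $f$ have at most $k$ elements, and
  those of the points outside $B$ have exactly $k$, then the image has about $|T| / k$ elements.
  Each smaller fibre lies in $B$, so charging $k$ to one of its members bounds the error.
\<close>

lemma card_image_bounds:
  fixes f :: "'a \<Rightarrow> 'b"
  assumes fin: "finite T"
    and le: "\<And>t. t \<in> T \<Longrightarrow> card {s \<in> T. f s = f t} \<le> k"
    and eq: "\<And>t. t \<in> T - B \<Longrightarrow> card {s \<in> T. f s = f t} = k"
  shows "card T \<le> k * card (f ` T)" "k * card (f ` T) \<le> card T + k * card (T \<inter> B)"
proof -
  have split: "card X = (\<Sum>y\<in>f ` T. card {s \<in> X. f s = y})" if "X \<subseteq> T" for X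
  proof -
    have "card X = (\<Sum>y\<in>f ` X. card {s \<in> X. f s = y})"
      using sum.image_gen[of X "\<lambda>_. 1::nat" f] finite_subset[OF that fin] by simp
    also have "\<dots> = (\<Sum>y\<in>f ` T. card {s \<in> X. f s = y})"
      using that fin by (intro sum.mono_neutral_left) (auto simp: card_eq_0_iff, metis imageI)
    finally show ?thesis .
  qed
  have "card T = (\<Sum>y\<in>f ` T. card {s \<in> T. f s = y})" by (rule split) simp
  also have "\<dots> \<le> (\<Sum>y\<in>f ` T. k)" using le by (intro sum_mono) auto
  finally show "card T \<le> k * card (f ` T)" by (simp add: mult.commute)
  have "k * card (f ` T) = (\<Sum>y\<in>f ` T. k)" by simp
  also have "\<dots> \<le> (\<Sum>y\<in>f ` T. card {s \<in> T. f s = y} + k * card {s \<in> T \<inter> B. f s = y})"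
  proof (rule sum_mono)
    fix y assume y: "y \<in> f ` T"
    show "k \<le> card {s \<in> T. f s = y} + k * card {s \<in> T \<inter> B. f s = y}"
    proof (cases "{s \<in> T \<inter> B. f s = y} = {}")
      case True
      then obtain t where "t \<in> T - B" "y = f t" using y by blast
      then show ?thesis using eq by simp
    next
      case False
      then have "card {s \<in> T \<inter> B. f s = y} \<ge> 1" using fin by (simp add: Suc_le_eq card_gt_0_iff)
      then show ?thesis by (metis mult.right_neutral mult_le_mono2 trans_le_add2)
    qed
  qed
  also have "\<dots> = card T + k * card (T \<inter> B)"
    by (simp add: sum.distrib split[of T] split[of "T \<inter> B"] flip: sum_distrib_left)
  finally show "k * card (f ` T) \<le> card T + k * card (T \<inter> B)" .
qed

lemma card_residue_class_le:
  assumes "p > 0"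
  shows "card {t \<in> {0..<int p ^ 3}. int p dvd t - u} \<le> p^2"
proof -
  let ?S = "{t \<in> {0..<int p ^ 3}. int p dvd t - u}"
  have "inj_on (\<lambda>t. t div int p) ?S"
  proof
    fix s t assume st: "s \<in> ?S" "t \<in> ?S" "s div int p = t div int p"
    then have "s mod int p = u mod int p" "t mod int p = u mod int p" by (auto simp: mod_eq_dvd_iff)
    then show "s = t" using st(3) by (metis div_mult_mod_eq)
  qed
  moreover have "(\<lambda>t. t div int p) ` ?S \<subseteq> {0..<int p ^ 2}"
  proof -
    have "t div int p < int p ^ 2" if "t < int p ^ 3" for t
    proof -
      have "t div int p * int p \<le> t" using pos_mod_sign[of "int p" t] div_mult_mod_eq[of t "int p"] assms by linarith
      also have "\<dots> < int p ^ 2 * int p" using that by (simp add: power_numeral_reduce mult.assoc)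
      finally show ?thesis using assms by simp
    qed
    then show ?thesis using assms by (auto simp: pos_imp_zdiv_nonneg_iff)
  qed
  ultimately have "card ?S \<le> card {0..<int p ^ 2}" by (intro card_inj_on_le) auto
  then show ?thesis by (simp add: nat_power_eq)
qed

lemma finite_interval_filter: "finite {t \<in> {0..<n :: int}. P t}"
  by (rule finite_subset[of _ "{0..<n}"]) auto

text \<open>
  Given one root $u$, every root modulo $p$ is congruent to $u$ or to $-a-u$ because
  $(t^2 + a t + 1) - (u^2 + a u + 1) = (t - u)(t + a + u)$.
\<close>

lemma card_quadratic_roots_le:
  assumes p: "prime p"
  shows "card {t \<in> {0..<int p ^ 3}. int p dvd t^2 + a * t + 1} \<le> 2 * p^2"
proof (cases "{t \<in> {0..<int p ^ 3}. int p dvd t^2 + a * t + 1} = {}")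
  case True
  show ?thesis unfolding True by simp
next
  case False
  then obtain u where u: "int p dvd u^2 + a * u + 1" by blast
  have "{t \<in> {0..<int p ^ 3}. int p dvd t^2 + a * t + 1} \<subseteq>
     {t \<in> {0..<int p ^ 3}. int p dvd t - u} \<union> {t \<in> {0..<int p ^ 3}. int p dvd t - (- a - u)}"
  proof (rule subsetI)
    fix t assume t: "t \<in> {t \<in> {0..<int p ^ 3}. int p dvd t^2 + a * t + 1}"
    have "int p dvd (t^2 + a * t + 1) - (u^2 + a * u + 1)" using t u by (intro dvd_diff) auto
    also have "(t^2 + a * t + 1) - (u^2 + a * u + 1) = (t - u) * (t - (- a - u))" by algebra
    finally have "int p dvd (t - u) * (t - (- a - u))" .
    then show "t \<in> {t \<in> {0..<int p ^ 3}. int p dvd t - u} \<union> {t \<in> {0..<int p ^ 3}. int p dvd t - (- a - u)}"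
      using p t by (auto simp: prime_dvd_mult_iff)
  qed
  then have "card {t \<in> {0..<int p ^ 3}. int p dvd t^2 + a * t + 1} \<le>
     card ({t \<in> {0..<int p ^ 3}. int p dvd t - u} \<union> {t \<in> {0..<int p ^ 3}. int p dvd t - (- a - u)})"
    by (intro card_mono finite_UnI finite_interval_filter)
  also have "\<dots> \<le> p^2 + p^2"
    using card_residue_class_le[of p] p by (intro order.trans[OF card_Un_le] add_mono) (auto simp: prime_gt_0_nat)
  finally show ?thesis by simp
qed

section \<open>The fibres over $j = 1728$ and $j = 0$\<close>

text \<open>
  The fixed point equation $c z^2 + (d - a') z - b' = 0$ must be a multiple of $z^2 - a z + 1 = 0$,
  because $1$ and $z$ are linearly independent over $\mathbb{Q}$.  Treating $z = i$ (with $a = 0$) and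
  $z = e^{i \pi / 3}$ (with $a = 1$) as roots of this one family handles both elliptic points together.
\<close>

lemma stabiliser_imaginary_quadratic:
  assumes z: "z^2 = of_int a * z - 1" "Im z \<noteq> 0" and M: "M \<in> SL2Z"
  shows "moebius_act M (Some z) = Some z \<longleftrightarrow>
    M $ 1 $ 1 = M $ 2 $ 2 + a * M $ 2 $ 1 \<and> M $ 1 $ 2 = - (M $ 2 $ 1)"
proof -
  have indep: "of_int m * z + of_int n = 0 \<longleftrightarrow> m = 0 \<and> n = 0" for m n :: int
    using z(2) by (auto simp: complex_eq_iff)
  have nz: "of_int (M $ 2 $ 1) * z + of_int (M $ 2 $ 2) \<noteq> 0"
    using M unfolding indep by (auto simp: SL2Z_iff)
  then have "moebius_act M (Some z) = Some z \<longleftrightarrow>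
     of_int (M $ 1 $ 1) * z + of_int (M $ 1 $ 2) = z * (of_int (M $ 2 $ 1) * z + of_int (M $ 2 $ 2))"
    by (simp add: moebius_act_def divide_eq_eq)
  also have "\<dots> \<longleftrightarrow> of_int (M $ 1 $ 1) * z + of_int (M $ 1 $ 2)
      = of_int (M $ 2 $ 1) * (of_int a * z - 1) + of_int (M $ 2 $ 2) * z"
  proof -
    have "z * (of_int (M $ 2 $ 1) * z + of_int (M $ 2 $ 2))
        = of_int (M $ 2 $ 1) * (of_int a * z - 1) + of_int (M $ 2 $ 2) * z"
      unfolding z(1)[symmetric] by (simp add: algebra_simps power2_eq_square)
    then show ?thesis by simp
  qed
  also have "\<dots> \<longleftrightarrow> of_int (M $ 1 $ 1 - M $ 2 $ 2 - a * M $ 2 $ 1) * z + of_int (M $ 1 $ 2 + M $ 2 $ 1) = 0"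
    by (auto simp: algebra_simps add_eq_0_iff)
  also have "\<dots> \<longleftrightarrow> M $ 1 $ 1 = M $ 2 $ 2 + a * M $ 2 $ 1 \<and> M $ 1 $ 2 = - (M $ 2 $ 1)"
    unfolding indep by auto
  finally show ?thesis .
qed

text \<open>
  An element of the stabiliser is given by its bottom row $(c, d)$, and having determinant $1$ means
  that $(c, d)$ is a vector of norm $1$ for the form $d^2 + a c d + c^2$, that is, a unit of
  $\mathbb{Z}[z]$.
\<close>

lemma X0_point_affine_rep_eq_iff:
  assumes z: "z^2 = of_int a * z - 1" "Im z \<noteq> 0"
  shows "X0_point N (moebius_act (affine_rep s) (Some z)) = X0_point N (moebius_act (affine_rep t) (Some z)) \<longleftrightarrow>
    (\<exists>c d. d^2 + a * c * d + c^2 = 1 \<and> int N dvd d * (s - t) + c * ((t + a) * s + 1))"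
proof -
  have "X0_point N (moebius_act (affine_rep s) (Some z)) = X0_point N (moebius_act (affine_rep t) (Some z)) \<longleftrightarrow>
    (\<exists>M\<in>SL2Z. moebius_act M (Some z) = Some z \<and> row_equiv N (affine_rep t ** M) (affine_rep s))"
    by (subst eq_commute) (rule X0_point_eq_iff[OF affine_rep_SL2Z affine_rep_SL2Z])
  also have "\<dots> \<longleftrightarrow> (\<exists>c d. d^2 + a * c * d + c^2 = 1 \<and> int N dvd d * (s - t) + c * ((t + a) * s + 1))"
  proof safe
    fix M assume M: "M \<in> SL2Z" "moebius_act M (Some z) = Some z" "row_equiv N (affine_rep t ** M) (affine_rep s)"
    let ?c = "M $ 2 $ 1" and ?d = "M $ 2 $ 2"
    have e: "M $ 1 $ 1 = ?d + a * ?c" "M $ 1 $ 2 = - ?c"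
      using M(2) stabiliser_imaginary_quadratic[OF z M(1)] by auto
    have "?d^2 + a * ?c * ?d + ?c^2 = 1"
      using M(1) by (simp add: SL2Z_iff e power2_eq_square algebra_simps)
    moreover have "int N dvd ?d * (s - t) + ?c * ((t + a) * s + 1)"
      using M(3) by (simp add: row_equiv_affine_rep_iff mult_entry e) (simp add: affine_rep_def algebra_simps)
    ultimately show "\<exists>c d. d^2 + a * c * d + c^2 = 1 \<and> int N dvd d * (s - t) + c * ((t + a) * s + 1)"
      by blast
  next
    fix c d assume cd: "d^2 + a * c * d + c^2 = 1" "int N dvd d * (s - t) + c * ((t + a) * s + 1)"
    let ?M = "mat2 (d + a * c) (- c) c d"
    have M: "?M \<in> SL2Z" using cd(1) by (simp add: SL2Z_iff power2_eq_square algebra_simps)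
    moreover have "moebius_act ?M (Some z) = Some z"
      using stabiliser_imaginary_quadratic[OF z M] by simp
    moreover have "row_equiv N (affine_rep t ** ?M) (affine_rep s)"
      using cd(2) by (simp add: row_equiv_affine_rep_iff mult_entry) (simp add: affine_rep_def algebra_simps)
    ultimately show "\<exists>M\<in>SL2Z. moebius_act M (Some z) = Some z \<and> row_equiv N (affine_rep t ** M) (affine_rep s)" by blast
  qed
  finally show ?thesis .
qed

lemma norm_form_0_units:
  fixes c d :: int
  shows "d^2 + c^2 = 1 \<longleftrightarrow> (c = 0 \<and> \<bar>d\<bar> = 1) \<or> (d = 0 \<and> \<bar>c\<bar> = 1)"
proof
  assume eq: "d^2 + c^2 = 1"
  show "(c = 0 \<and> \<bar>d\<bar> = 1) \<or> (d = 0 \<and> \<bar>c\<bar> = 1)"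
  proof (cases "c = 0")
    case True
    then show ?thesis using eq by (simp add: abs_square_eq_1)
  next
    case False
    then have "c^2 \<ge> 1" by (simp add: Suc_le_eq int_one_le_iff_zero_less)
    then have "d^2 = 0" using eq zero_le_power2[of d] by linarith
    then show ?thesis using eq by (simp add: abs_square_eq_1)
  qed
qed (auto simp: abs_square_eq_1)

lemma norm_form_1_units:
  fixes c d :: int
  shows "d^2 + c * d + c^2 = 1 \<longleftrightarrow> (c = 0 \<and> \<bar>d\<bar> = 1) \<or> (d = 0 \<and> \<bar>c\<bar> = 1) \<or> (c = - d \<and> \<bar>d\<bar> = 1)"
proof
  assume eq: "d^2 + c * d + c^2 = 1"
  \<comment> \<open>Twice the form is a sum of three squares, one of which must vanish here.\<close>
  have *: "(c + d)^2 + c^2 + d^2 = 2" using eq by (simp add: power2_eq_square algebra_simps)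
  have big: "x^2 \<ge> 1" if "x \<noteq> 0" for x :: int using that by (simp add: int_one_le_iff_zero_less)
  have "c = 0 \<or> d = 0 \<or> c + d = 0" using * big[of c] big[of d] big[of "c + d"] by linarith
  then show "(c = 0 \<and> \<bar>d\<bar> = 1) \<or> (d = 0 \<and> \<bar>c\<bar> = 1) \<or> (c = - d \<and> \<bar>d\<bar> = 1)"
    using eq by (auto simp: abs_square_eq_1 add_eq_0_iff2 power2_eq_square) (auto simp: abs_square_eq_1 power2_eq_square[symmetric])
qed (auto simp: abs_square_eq_1 power2_eq_square abs_if split: if_splits)

text \<open>
  Besides $\pm 1$ there are the units $\pm i$; they identify $t$ with $-1/t$.
\<close>

lemma X0_point_affine_rep_i_eq_iff:
  "X0_point N (moebius_act (affine_rep s) (Some \<i>)) = X0_point N (moebius_act (affine_rep t) (Some \<i>)) \<longleftrightarrow>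
    int N dvd s - t \<or> int N dvd t * s + 1"
proof -
  have "X0_point N (moebius_act (affine_rep s) (Some \<i>)) = X0_point N (moebius_act (affine_rep t) (Some \<i>)) \<longleftrightarrow>
    (\<exists>c d. d^2 + c^2 = 1 \<and> int N dvd d * (s - t) + c * (t * s + 1))"
    using X0_point_affine_rep_eq_iff[of \<i> 0 N s t] by simp
  also have "\<dots> \<longleftrightarrow> int N dvd s - t \<or> int N dvd t * s + 1"
    unfolding norm_form_0_units
  proof safe
    fix c d :: int
    assume "\<bar>d\<bar> = 1" "int N dvd d * (s - t) + 0 * (t * s + 1)" "\<not> int N dvd t * s + 1"
    then show "int N dvd s - t" by (auto simp: abs_if dvd_diff_commute split: if_splits)
  next
    fix c d :: int
    assume "\<bar>c\<bar> = 1" "int N dvd 0 * (s - t) + c * (t * s + 1)" "\<not> int N dvd t * s + 1"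
    then have "int N dvd - (t * s + 1)" "\<not> int N dvd t * s + 1" by (auto simp: abs_if split: if_splits)
    then show "int N dvd s - t" by (simp only: dvd_minus_iff)
  next
    assume "int N dvd s - t"
    then show "\<exists>c d. (c = 0 \<and> \<bar>d\<bar> = 1 \<or> d = 0 \<and> \<bar>c\<bar> = 1) \<and> int N dvd d * (s - t) + c * (t * s + 1)"
      by (intro exI[of _ 0] exI[of _ 1]) simp
  next
    assume "int N dvd t * s + 1"
    then show "\<exists>c d. (c = 0 \<and> \<bar>d\<bar> = 1 \<or> d = 0 \<and> \<bar>c\<bar> = 1) \<and> int N dvd d * (s - t) + c * (t * s + 1)"
      by (intro exI[of _ 1] exI[of _ 0]) simp
  qed
  finally show ?thesis .
qed

lemma cis_pi_3: "cis (pi / 3) ^ 2 = of_int 1 * cis (pi / 3) - 1" "Im (cis (pi / 3)) \<noteq> 0"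
  by (auto simp: complex_eq_iff power2_eq_square cos_60 sin_60)

text \<open>
  The six units give, modulo sign, the group of order three generated by $t \mapsto -1/(t+1)$, whose
  square is $t \mapsto -(t+1)/t$.
\<close>

lemma X0_point_affine_rep_rho_eq_iff:
  "X0_point N (moebius_act (affine_rep s) (Some (cis (pi / 3)))) = X0_point N (moebius_act (affine_rep t) (Some (cis (pi / 3)))) \<longleftrightarrow>
    int N dvd s - t \<or> int N dvd (t + 1) * s + 1 \<or> int N dvd t * (s + 1) + 1"
proof -
  define m n where "m = s - t" and "n = (t + 1) * s + 1"
  have mn: "t * (s + 1) + 1 = n - m" by (simp add: m_def n_def algebra_simps)
  have "X0_point N (moebius_act (affine_rep s) (Some (cis (pi / 3)))) = X0_point N (moebius_act (affine_rep t) (Some (cis (pi / 3)))) \<longleftrightarrow>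
    (\<exists>c d. d^2 + c * d + c^2 = 1 \<and> int N dvd d * m + c * n)"
    using X0_point_affine_rep_eq_iff[OF cis_pi_3, of N s t] by (simp add: m_def n_def)
  also have "\<dots> \<longleftrightarrow> int N dvd m \<or> int N dvd n \<or> int N dvd n - m"
    unfolding norm_form_1_units
  proof
    assume "\<exists>c d. (c = 0 \<and> \<bar>d\<bar> = 1 \<or> d = 0 \<and> \<bar>c\<bar> = 1 \<or> c = - d \<and> \<bar>d\<bar> = 1) \<and> int N dvd d * m + c * n"
    then obtain c d where "c = 0 \<and> (d = 1 \<or> d = -1) \<or> d = 0 \<and> (c = 1 \<or> c = -1) \<or> c = - d \<and> (d = 1 \<or> d = -1)"
      and "int N dvd d * m + c * n" by (auto simp: abs_if split: if_splits)
    then show "int N dvd m \<or> int N dvd n \<or> int N dvd n - m" using dvd_diff_commute[of "int N" m n] by auto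
  next
    assume "int N dvd m \<or> int N dvd n \<or> int N dvd n - m"
    then show "\<exists>c d. (c = 0 \<and> \<bar>d\<bar> = 1 \<or> d = 0 \<and> \<bar>c\<bar> = 1 \<or> c = - d \<and> \<bar>d\<bar> = 1) \<and> int N dvd d * m + c * n" (is "\<exists>c d. ?P c d")
    proof (elim disjE)
      assume "int N dvd m"
      then have "?P 0 1" by simp
      then show ?thesis by blast
    next
      assume "int N dvd n"
      then have "?P 1 0" by simp
      then show ?thesis by blast
    next
      assume "int N dvd n - m"
      then have "?P 1 (-1)" by simp
      then show ?thesis by blast
    qed
  qed
  finally show ?thesis unfolding mn unfolding m_def n_def .
qed

text \<open>
  The image of an affine point under a nontrivial element of the stabiliser modulo sign solves a
  congruence of this shape; the leading coefficient is a unit when the image is again affine.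
\<close>

lemma unique_solution_mod_prime_cube:
  fixes a b :: int
  assumes p: "prime p" and a: "\<not> int p dvd a"
  obtains u where "{s \<in> {0..<int p ^ 3}. int p ^ 3 dvd a * s + b} = {u}"
proof -
  have cop: "coprime a (int p ^ 3)" using coprime_prime_cube[OF p a] by simp
  moreover have "int p ^ 3 > 0" using p by (simp add: prime_gt_0_nat)
  ultimately obtain u where u: "u \<in> {0..<int p ^ 3}" "int p ^ 3 dvd a * u - (- b)"
    by (rule coprime_solve_mod)
  have "s = u" if "s \<in> {0..<int p ^ 3}" "int p ^ 3 dvd a * s + b" for s
  proof -
    have "int p ^ 3 dvd (a * s + b) - (a * u - (- b))" using u(2) that(2) by (rule dvd_diff[rotated])
    then have "int p ^ 3 dvd a * (s - u)" by (simp add: algebra_simps)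
    then have "int p ^ 3 dvd s - u" using cop by (simp add: coprime_dvd_mult_right_iff coprime_commute)
    then have "[s = u] (mod int p ^ 3)" by (simp add: cong_iff_dvd_diff)
    then show "s = u" using u(1) that(1) by (simp add: cong_def)
  qed
  moreover have "int p ^ 3 dvd a * u + b" using u(2) by simp
  ultimately have "{s \<in> {0..<int p ^ 3}. int p ^ 3 dvd a * s + b} = {u}" using u(1) by blast
  then show thesis by (rule that)
qed

lemma card_inverse_mod_prime_cube_le_1:
  assumes p: "prime p"
  shows "card {s \<in> {0..<int p ^ 3}. int p ^ 3 dvd a * (s + c) + 1} \<le> 1"
proof (cases "int p dvd a")
  case True
  have False if "int p ^ 3 dvd a * (s + c) + 1" for s
  proof -
    have "int p dvd a * (s + c) + 1" using that by (rule dvd_trans[rotated]) simp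
    then have "int p dvd 1" using True by (simp add: dvd_add_right_iff)
    then show False using p by auto
  qed
  then have e: "{s \<in> {0..<int p ^ 3}. int p ^ 3 dvd a * (s + c) + 1} = {}" by blast
  show ?thesis unfolding e by simp
next
  case False
  obtain u where "{s \<in> {0..<int p ^ 3}. int p ^ 3 dvd a * s + (a * c + 1)} = {u}"
    using unique_solution_mod_prime_cube[OF p False] .
  then have "{s \<in> {0..<int p ^ 3}. int p ^ 3 dvd a * (s + c) + 1} = {u}" by (simp add: distrib_left add.assoc)
  then show ?thesis by simp
qed

lemma residue_unique:
  fixes n :: int
  assumes "t \<in> {0..<n}" shows "{s \<in> {0..<n}. n dvd s - t} = {t}"
  using assms by (auto simp flip: mod_eq_dvd_iff)

text \<open>
  The parameters modulo $p$ whose orbit under the stabiliser leaves the affine part (the two linear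
  conditions) or has fewer elements than the stabiliser modulo sign (the quadratic one, which is the
  fixed point equation of the generator).
\<close>

definition exceptional :: "nat \<Rightarrow> int \<Rightarrow> int set" where
  "exceptional p a = {t. int p dvd t \<or> int p dvd t + a \<or> int p dvd t^2 + a * t + 1}"

lemma card_exceptional_le:
  assumes p: "prime p"
  shows "card ({0..<int p ^ 3} \<inter> exceptional p a) \<le> 4 * p^2"
proof -
  let ?S = "\<lambda>u. {t \<in> {0..<int p ^ 3}. int p dvd t - u}" and ?Q = "{t \<in> {0..<int p ^ 3}. int p dvd t^2 + a * t + 1}"
  have "{0..<int p ^ 3} \<inter> exceptional p a = ?S 0 \<union> ?S (- a) \<union> ?Q" by (auto simp: exceptional_def)
  then have "card ({0..<int p ^ 3} \<inter> exceptional p a) = card (?S 0 \<union> ?S (- a) \<union> ?Q)" by (rule arg_cong)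
  also have "\<dots> \<le> card (?S 0) + card (?S (- a)) + card ?Q"
    using card_Un_le[of "?S 0 \<union> ?S (- a)" ?Q] card_Un_le[of "?S 0" "?S (- a)"] by linarith
  also have "\<dots> \<le> p^2 + p^2 + 2 * p^2"
    using p by (intro add_mono card_residue_class_le card_quadratic_roots_le) (auto simp: prime_gt_0_nat)
  finally show ?thesis by simp
qed

text \<open>
  Outside the at most $4 p^2$ exceptional parameters the orbit of $t$ is $\{t, -1/t\}$ with two distinct
  members.  The error $10 p^2$ is $2 \cdot 4 p^2$ from these and $2 p^2$ from the residual points.
\<close>

lemma card_fibre_i_bounds:
  assumes p: "prime p"
  shows "p^3 \<le> 2 * card (X0_fibre (p^3) (Some \<i>))"
    and "2 * card (X0_fibre (p^3) (Some \<i>)) \<le> p^3 + 10 * p^2"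
proof -
  let ?T = "{0..<int p ^ 3}"
  define f where "f t = X0_point (p^3) (moebius_act (affine_rep t) (Some \<i>))" for t
  define S where "S t = {s \<in> ?T. int p ^ 3 dvd t * s + 1}" for t
  have eq: "{s \<in> ?T. f s = f t} = insert t (S t)" if "t \<in> ?T" for t
    using residue_unique[OF that] by (auto simp: f_def X0_point_affine_rep_i_eq_iff S_def)
  have "card {s \<in> ?T. f s = f t} \<le> 2" if "t \<in> ?T" for t
    using card_inverse_mod_prime_cube_le_1[OF p, of t 0] unfolding eq[OF that] S_def
    by (intro order.trans[OF card_insert_le_m1]) auto
  moreover have "card {s \<in> ?T. f s = f t} = 2" if t: "t \<in> ?T - exceptional p 0" for t
  proof -
    have t': "t \<in> ?T" "\<not> int p dvd t" "\<not> int p dvd t^2 + 1" using t by (auto simp: exceptional_def)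
    obtain u where u: "S t = {u}" using unique_solution_mod_prime_cube[OF p t'(2), of 1] unfolding S_def .
    have "t \<notin> S t" using t'(3) dvd_trans[of "int p" "int p ^ 3"] by (auto simp: S_def power2_eq_square)
    then show ?thesis unfolding eq[OF t'(1)] u by (simp add: card_insert_if)
  qed
  ultimately have *: "card ?T \<le> 2 * card (f ` ?T)" "2 * card (f ` ?T) \<le> card ?T + 2 * card (?T \<inter> exceptional p 0)"
    using card_image_bounds[of ?T f 2 "exceptional p 0"] by auto
  show "p^3 \<le> 2 * card (X0_fibre (p^3) (Some \<i>))" "2 * card (X0_fibre (p^3) (Some \<i>)) \<le> p^3 + 10 * p^2"
    using * X0_fibre_card_bounds[OF p, of "Some \<i>"] card_exceptional_le[OF p, of 0]
    by (simp_all add: f_def[abs_def] nat_power_eq)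
qed

text \<open>
  The same with the orbits $\{t, -1/(t+1), -(t+1)/t\}$ of three members, and thus with the error
  $3 \cdot 4 p^2 + 3 p^2$.
\<close>

lemma card_fibre_rho_bounds:
  assumes p: "prime p"
  shows "p^3 \<le> 3 * card (X0_fibre (p^3) (Some (cis (pi / 3))))"
    and "3 * card (X0_fibre (p^3) (Some (cis (pi / 3)))) \<le> p^3 + 15 * p^2"
proof -
  let ?T = "{0..<int p ^ 3}"
  define f where "f t = X0_point (p^3) (moebius_act (affine_rep t) (Some (cis (pi / 3))))" for t
  define S where "S t = {s \<in> ?T. int p ^ 3 dvd (t + 1) * s + 1}" for t
  define R where "R t = {s \<in> ?T. int p ^ 3 dvd t * (s + 1) + 1}" for t
  have eq: "{s \<in> ?T. f s = f t} = insert t (S t \<union> R t)" if "t \<in> ?T" for t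
    using residue_unique[OF that] by (auto simp: f_def X0_point_affine_rep_rho_eq_iff S_def R_def)
  have "card {s \<in> ?T. f s = f t} \<le> 3" if "t \<in> ?T" for t
  proof -
    have "card (S t) \<le> 1" "card (R t) \<le> 1"
      using card_inverse_mod_prime_cube_le_1[OF p, of "t + 1" 0] card_inverse_mod_prime_cube_le_1[OF p, of t 1] by (simp_all add: S_def R_def)
    then have "card (S t \<union> R t) \<le> 2" using card_Un_le[of "S t" "R t"] by simp
    moreover have "finite (S t \<union> R t)" unfolding S_def R_def by (intro finite_UnI finite_interval_filter)
    ultimately show ?thesis unfolding eq[OF that] by (simp add: card_insert_if)
  qed
  moreover have "card {s \<in> ?T. f s = f t} = 3" if t: "t \<in> ?T - exceptional p 1" for t
  proof -
    have t': "t \<in> ?T" "\<not> int p dvd t" "\<not> int p dvd t + 1" "\<not> int p dvd t^2 + t + 1"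
      using t by (auto simp: exceptional_def)
    obtain u where u: "S t = {u}" using unique_solution_mod_prime_cube[OF p t'(3), of 1] unfolding S_def .
    obtain v where "{s \<in> ?T. int p ^ 3 dvd t * s + (t + 1)} = {v}"
      using unique_solution_mod_prime_cube[OF p t'(2)] .
    then have v: "R t = {v}" by (simp add: R_def distrib_left add.assoc)
    have "\<not> int p ^ 3 dvd t^2 + t + 1" using t'(4) dvd_trans[of "int p" "int p ^ 3"] by auto
    moreover have "(t + 1) * t + 1 = t^2 + t + 1" by algebra
    ultimately have "t \<notin> S t" unfolding S_def by (metis (no_types, lifting) mem_Collect_eq)
    have "\<not> int p ^ 3 dvd t^2 + t + 1" using t'(4) dvd_trans[of "int p" "int p ^ 3"] by auto
    moreover have "t * (t + 1) + 1 = t^2 + t + 1" by algebra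
    ultimately have "t \<notin> R t" unfolding R_def by (metis (no_types, lifting) mem_Collect_eq)
    \<comment> \<open>The two defining congruences differ by $s - t$, so a common solution would be the point itself.\<close>
    have "u \<noteq> v"
    proof
      assume "u = v"
      then have "u \<in> S t" "u \<in> R t" using u v by simp_all
      then have "u \<in> ?T" and uu: "int p ^ 3 dvd (t + 1) * u + 1" "int p ^ 3 dvd t * (u + 1) + 1"
        unfolding S_def R_def by blast+
      from uu have "int p ^ 3 dvd ((t + 1) * u + 1) - (t * (u + 1) + 1)" by (intro dvd_diff)
      also have "((t + 1) * u + 1) - (t * (u + 1) + 1) = u - t" by algebra
      finally have "u \<in> {s \<in> ?T. int p ^ 3 dvd s - t}" using \<open>u \<in> ?T\<close> by blast
      then have "u = t" unfolding residue_unique[OF t'(1)] by blast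
      then show False using u \<open>t \<notin> S t\<close> by simp
    qed
    then show ?thesis using \<open>t \<notin> S t\<close> \<open>t \<notin> R t\<close> unfolding eq[OF t'(1)] u v by (auto simp: card_insert_if)
  qed
  ultimately have *: "card ?T \<le> 3 * card (f ` ?T)" "3 * card (f ` ?T) \<le> card ?T + 3 * card (?T \<inter> exceptional p 1)"
    using card_image_bounds[of ?T f 3 "exceptional p 1"] by auto
  show "p^3 \<le> 3 * card (X0_fibre (p^3) (Some (cis (pi / 3))))"
    "3 * card (X0_fibre (p^3) (Some (cis (pi / 3)))) \<le> p^3 + 15 * p^2"
    using * X0_fibre_card_bounds[OF p, of "Some (cis (pi / 3))"] card_exceptional_le[OF p, of 1]
    by (simp_all add: f_def[abs_def] nat_power_eq)
qed

section \<open>The genus of $X_0(p^3)$ up to $O(p^2)$\<close>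

text \<open>
  By Riemann-Hurwitz $2 g - 2 = d - n_{1728} - n_0 - n_\infty$, whose leading term is
  $p^3 (1 - 1/2 - 1/3) = p^3/6$.  The errors of the four counts are at most $p^2$, $5 p^2$, $5 p^2$ and
  $1 + p^2$, and half of their sum is below $7 p^2$.
\<close>

lemma genus_X0_prime_cube_bounds:
  assumes p: "prime p"
  shows "\<bar>genus_X0 (p^3) - real p ^ 3 / 12\<bar> \<le> 7 * real p ^ 2"
proof -
  note bounds = card_fibre_i_bounds[OF p] card_fibre_rho_bounds[OF p] card_cusps_le[OF p] X0_degree_bounds[OF p]
  have real_le: "real m \<le> real n" if "m \<le> n" for m n using that by simp
  have "\<bar>1 + (- 2 * d + (d - m) + (d - n) + (d - c)) / 2 - P / 12\<bar> \<le> 7 * Q"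
    if "P \<le> 2 * m" "2 * m \<le> P + 10 * Q" "P \<le> 3 * n" "3 * n \<le> P + 15 * Q" "0 \<le> c" "c \<le> 1 + Q"
      "P \<le> d" "d \<le> P + Q" "1 \<le> Q" for d m n c P Q :: real
    unfolding abs_le_iff by (rule conjI; use that in argo)
  note arith = this
  have "real p ^ 2 \<ge> 1" using prime_ge_1_nat[OF p] by simp
  note real_bounds = bounds[THEN real_le, unfolded of_nat_add of_nat_mult of_nat_power of_nat_numeral of_nat_1] this
  show ?thesis
    unfolding genus_X0_def
    by (rule arith[OF real_bounds(1-4) of_nat_0_le_iff real_bounds(5-8)])
qed

section \<open>Intersection numbers of $V_0$ and $V_\infty$\<close>

text \<open>
  The coefficients of $V_0$ over their common denominator $6 (p^4 - p^2)$.  Working with these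
  polynomials turns every intersection number into a polynomial identity.
\<close>

primrec V0_numerator :: "rat \<Rightarrow> component \<Rightarrow> rat" where
  "V0_numerator q C30 = 10 * q^4 - 4 * q^3 - 50 * q^2 - 96 * q + 12"
| "V0_numerator q C03 = - 8 * q^4 - 16 * q^3 + 172 * q^2 - 60 * q - 24"
| "V0_numerator q C21 = (4 * q^4 + 2 * q^3 - 38 * q^2 - 60 * q + 12) * (q - 1)"
| "V0_numerator q C12 = (- 2 * q^4 + 2 * q^3 + 40 * q^2 - 96 * q - 24) * (q - 1)"
| "V0_numerator q E1 = (2 * q^4 + q^3 - 19 * q^2 - 30 * q + 6) * (q - 1)"
| "V0_numerator q E2 = (- (q^4) + q^3 + 20 * q^2 - 48 * q - 12) * (q - 1)"
| "V0_numerator q F1 = (2 * q^3 + 2 * q^2 - 24 * q - 12) * (q^2 + q)"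
| "V0_numerator q F2 = 0"

lemma denominators_nonzero:
  fixes q :: rat
  assumes "q > 1"
  shows "q^4 - q^2 \<noteq> 0" "q^3 + q^2 \<noteq> 0" "q^2 - q \<noteq> 0"
proof -
  have "q^4 > q^2" "q^3 > 0" "q^2 > q" "q^2 > 0"
    using assms power_strict_increasing[of 2 4 q] power_strict_increasing[of 1 2 q] by auto
  then show "q^4 - q^2 \<noteq> 0" "q^3 + q^2 \<noteq> 0" "q^2 - q \<noteq> 0" by linarith+
qed

lemma divide_eq_divide:
  fixes a b c d :: rat
  assumes "a * d = b * c" "c \<noteq> 0" "d \<noteq> 0"
  shows "a / c = b / d"
  using assms by (simp add: frac_eq_eq)

lemma V0_coeff_eq:
  assumes "q > 1"
  shows "V0_coeff q C = V0_numerator q C / (6 * (q^4 - q^2))"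
proof -
  have nz: "6 * (q^4 - q^2) \<noteq> 0" using denominators_nonzero[OF assms] by simp
  note eq = denominators_nonzero[OF assms, THEN divide_eq_divide[OF _ _ nz, rotated]]
  show ?thesis
  proof (cases C)
    case C30
    show ?thesis unfolding C30 V0_coeff.simps V0_numerator.simps by (rule eq(1)) algebra
  next
    case C03
    show ?thesis unfolding C03 V0_coeff.simps V0_numerator.simps by (rule eq(1)) algebra
  next
    case C21
    show ?thesis unfolding C21 V0_coeff.simps V0_numerator.simps by (rule eq(2)) algebra
  next
    case C12
    show ?thesis unfolding C12 V0_coeff.simps V0_numerator.simps by (rule eq(2)) algebra
  next
    case E1
    show ?thesis unfolding E1 V0_coeff.simps V0_numerator.simps by (rule eq(2)) algebra
  next
    case E2
    show ?thesis unfolding E2 V0_coeff.simps V0_numerator.simps by (rule eq(2)) algebra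
  next
    case F1
    show ?thesis unfolding F1 V0_coeff.simps V0_numerator.simps by (rule eq(3)) algebra
  next
    case F2
    show ?thesis unfolding F2 V0_coeff.simps V0_numerator.simps by simp
  qed
qed

lemma sum_component:
  fixes f :: "component \<Rightarrow> rat"
  shows "(\<Sum>C\<in>UNIV. f C) = f C30 + f C03 + f C21 + f C12 + f E1 + f E2 + f F1 + f F2"
  by (simp add: UNIV_component)

lemmas intersection_sum = sum_component component_intersection.simps component.case

text \<open>
  Since $K - (2 g - 2) H_0 + V_0$ is orthogonal to vertical divisors, $V_0 \cdot C$ equals
  $(2 g - 2) H_0 \cdot C - K \cdot C$, where $K \cdot C = -2 - C^2$ by adjunction (the
  components have arithmetic genus $0$) and $H_0$ meets only $C_{0,3}$.  These are the values below; they are checked directly from the matrix.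
\<close>

lemma V0_dot_component:
  fixes q :: rat
  assumes "q > 1"
  shows "(\<Sum>D\<in>UNIV. V0_coeff q D * component_intersection q C D) =
    case_component (- ((q^3 - q^2 - 16) / 12)) ((q^3 + 3 * q^2 - 24 * q + 4) / 12) ((5 - q) / 6) ((5 - q) / 6) 0 0 0 0 C"
    (is "_ = ?R C")
proof -
  have nz: "6 * (q^4 - q^2) \<noteq> 0" using denominators_nonzero[OF assms] by simp
  have "(\<Sum>D\<in>UNIV. V0_coeff q D * component_intersection q C D) =
      (\<Sum>D\<in>UNIV. V0_numerator q D * component_intersection q C D) / (6 * (q^4 - q^2))"
    by (simp add: V0_coeff_eq[OF assms] sum_divide_distrib)
  moreover have "(\<Sum>D\<in>UNIV. V0_numerator q D * component_intersection q C D) = ?R C * (6 * (q^4 - q^2))"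
  proof (cases C)
    case C30
    show ?thesis unfolding C30 intersection_sum V0_numerator.simps by algebra
  next
    case C03
    show ?thesis unfolding C03 intersection_sum V0_numerator.simps by algebra
  next
    case C21
    show ?thesis unfolding C21 intersection_sum V0_numerator.simps by algebra
  next
    case C12
    show ?thesis unfolding C12 intersection_sum V0_numerator.simps by algebra
  next
    case E1
    show ?thesis unfolding E1 intersection_sum V0_numerator.simps by algebra
  next
    case E2
    show ?thesis unfolding E2 intersection_sum V0_numerator.simps by algebra
  next
    case F1
    show ?thesis unfolding F1 intersection_sum V0_numerator.simps by algebra
  next
    case F2
    show ?thesis unfolding F2 intersection_sum V0_numerator.simps by algebra
  qed
  ultimately show ?thesis by (simp only: nonzero_mult_div_cancel_right[OF nz])
qed

text \<open>
  The symmetry of the configuration of components given by the Atkin-Lehner involution, which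
  exchanges the cusps $0$ and $\infty$.
\<close>

primrec atkin_lehner :: "component \<Rightarrow> component" where
  "atkin_lehner C30 = C03" | "atkin_lehner C03 = C30"
| "atkin_lehner C21 = C12" | "atkin_lehner C12 = C21"
| "atkin_lehner E1 = E2" | "atkin_lehner E2 = E1"
| "atkin_lehner F1 = F2" | "atkin_lehner F2 = F1"

text \<open>
  The fibre over $\mathbb{F}_p$ as a divisor.  The multiplicities are forced by orthogonality to every
  component, once $C_{3,0}$ is known to be reduced in the fibre.
\<close>

primrec fibre_multiplicity :: "rat \<Rightarrow> component \<Rightarrow> rat" where
  "fibre_multiplicity q C30 = 1" | "fibre_multiplicity q C03 = 1"
| "fibre_multiplicity q C21 = q - 1" | "fibre_multiplicity q C12 = q - 1"
| "fibre_multiplicity q E1 = (q - 1) / 2" | "fibre_multiplicity q E2 = (q - 1) / 2"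
| "fibre_multiplicity q F1 = q" | "fibre_multiplicity q F2 = q"

lemma sum_atkin_lehner: "(\<Sum>C\<in>UNIV. f (atkin_lehner C)) = (\<Sum>C\<in>UNIV. f C)"
  for f :: "component \<Rightarrow> rat"
  by (simp add: UNIV_component)

lemma component_intersection_atkin_lehner:
  "component_intersection q (atkin_lehner C) (atkin_lehner D) = component_intersection q C D"
  by (cases C; cases D; simp)

lemma fibre_dot_component: "(\<Sum>D\<in>UNIV. fibre_multiplicity q D * component_intersection q C D) = 0"
  by (cases C; simp add: sum_component field_simps power2_eq_square power3_eq_cube)

text \<open>
  The conditions that define $V_\infty$ are the mirror image of those for $V_0$, so the two divisors
  correspond under the involution up to a multiple of the fibre.  The multiple is dictated by the
  normalisation that the coefficient of $F_2$ vanishes, $F_2$ being the mirror image of $F_1$ and having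
  multiplicity $p$.
\<close>

lemma Vinf_coeff_eq:
  assumes "q > 1"
  shows "Vinf_coeff q C = V0_coeff q (atkin_lehner C) - V0_coeff q F1 / q * fibre_multiplicity q C"
proof -
  let ?l = "(2 * q^3 + 2 * q^2 - 24 * q - 12) * (q + 1)"
  have nz: "6 * (q^4 - q^2) \<noteq> 0" using denominators_nonzero[OF assms] by simp
  note eq = denominators_nonzero[OF assms, THEN divide_eq_divide[OF _ _ nz, rotated]]
  have l: "V0_coeff q F1 / q = ?l / (6 * (q^4 - q^2))"
  proof -
    have "V0_numerator q F1 = ?l * q" unfolding V0_numerator.simps by algebra
    then show ?thesis
      using assms by (simp add: V0_coeff_eq[OF assms] del: V0_coeff.simps V0_numerator.simps)
  qed
  note components_simps = Vinf_coeff.simps V0_numerator.simps atkin_lehner.simps fibre_multiplicity.simps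
  have "Vinf_coeff q C = (V0_numerator q (atkin_lehner C) - ?l * fibre_multiplicity q C) / (6 * (q^4 - q^2))"
  proof (cases C)
    case C30
    show ?thesis unfolding C30 components_simps
      by (rule eq(1)) algebra
  next
    case C03
    show ?thesis unfolding C03 components_simps
      by (rule eq(1)) algebra
  next
    case C21
    show ?thesis unfolding C21 components_simps
      by (rule eq(2)) algebra
  next
    case C12
    show ?thesis unfolding C12 components_simps
      by (rule eq(2)) algebra
  next
    case E1
    show ?thesis unfolding E1 components_simps
      by (rule eq(2)) algebra
  next
    case E2
    show ?thesis unfolding E2 components_simps
      by (rule eq(2)) algebra
  next
    case F1
    show ?thesis unfolding F1 components_simps
      by (rule eq(3)) algebra
  next
    case F2
    show ?thesis unfolding F2 components_simps
      by (simp add: power2_eq_square algebra_simps)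
  qed
  with l show ?thesis
    by (simp only: V0_coeff_eq[OF assms, of "atkin_lehner C"] diff_divide_distrib times_divide_eq_left)
qed

lemma Vinf_dot_component:
  assumes "q > 1"
  shows "(\<Sum>D\<in>UNIV. Vinf_coeff q D * component_intersection q C D) =
         (\<Sum>D\<in>UNIV. V0_coeff q D * component_intersection q (atkin_lehner C) D)"
proof -
  define l where "l = V0_coeff q F1 / q"
  have "(\<Sum>D\<in>UNIV. Vinf_coeff q D * component_intersection q C D) =
      (\<Sum>D\<in>UNIV. V0_coeff q (atkin_lehner D) * component_intersection q (atkin_lehner C) (atkin_lehner D))
      - l * (\<Sum>D\<in>UNIV. fibre_multiplicity q D * component_intersection q C D)"
    unfolding Vinf_coeff_eq[OF assms] component_intersection_atkin_lehner l_def[symmetric]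
    by (simp only: sum_distrib_left sum_subtractf left_diff_distrib mult.assoc)
  then show ?thesis
    using sum_atkin_lehner[of "\<lambda>D. V0_coeff q D * component_intersection q (atkin_lehner C) D"]
    by (simp add: fibre_dot_component)
qed

lemma intersection_number_alt:
  "intersection_number p V W = (\<Sum>C\<in>UNIV. V C * (\<Sum>D\<in>UNIV. W D * component_intersection (of_nat p) C D))"
  by (simp add: intersection_number_def sum_distrib_left mult.assoc)

lemma intersection_number_V0_V0:
  fixes p :: nat
  assumes "p > 1"
  defines "q \<equiv> of_nat p"
  shows "intersection_number p (V0 p) (V0 p) =
    (- (3 * q^7 + 5 * q^6 - 63 * q^5 - 173 * q^4 + 712 * q^3 + 100 * q^2 - 36 * q - 36)) / (12 * (q^4 - q^2))"
proof -
  have q: "q > 1" using assms by simp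
  have nz: "6 * (q^4 - q^2) \<noteq> 0" "12 * (q^4 - q^2) \<noteq> 0" using denominators_nonzero[OF q] by simp_all
  let ?v = "\<lambda>C. \<Sum>D\<in>UNIV. V0_coeff q D * component_intersection q C D"
  have "intersection_number p (V0 p) (V0 p) = (\<Sum>C\<in>UNIV. V0_coeff q C * ?v C)"
    by (simp add: intersection_number_alt V0_def flip: q_def)
  also have "\<dots> = (\<Sum>C\<in>UNIV. V0_numerator q C * ?v C) / (6 * (q^4 - q^2))"
    unfolding V0_dot_component[OF q] by (simp add: V0_coeff_eq[OF q] sum_divide_distrib)
  also have "\<dots> = (- (3 * q^7 + 5 * q^6 - 63 * q^5 - 173 * q^4 + 712 * q^3 + 100 * q^2 - 36 * q - 36)) / (12 * (q^4 - q^2))"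
    unfolding V0_dot_component[OF q]
    by (rule divide_eq_divide[OF _ nz]) (unfold intersection_sum V0_numerator.simps atkin_lehner.simps, algebra)
  finally show ?thesis .
qed

text \<open>
  Adding multiples of the fibre changes no intersection number, and the involution is an isometry.
\<close>

lemma intersection_number_Vinf_Vinf:
  assumes "p > 1"
  shows "intersection_number p (Vinf p) (Vinf p) = intersection_number p (V0 p) (V0 p)"
proof -
  define q :: rat where "q = of_nat p"
  have q: "q > 1" using assms by (simp add: q_def)
  define l where "l = V0_coeff q F1 / q"
  let ?v = "\<lambda>C. \<Sum>D\<in>UNIV. V0_coeff q D * component_intersection q C D"
  \<comment> \<open>The fibre is orthogonal to $V_0$, here seen on the mirror images.\<close>
  have fib: "(\<Sum>C\<in>UNIV. fibre_multiplicity q C * ?v (atkin_lehner C)) = 0"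
    unfolding V0_dot_component[OF q] by (simp add: sum_component field_simps power2_eq_square power3_eq_cube)
  have "intersection_number p (Vinf p) (Vinf p) = (\<Sum>C\<in>UNIV. Vinf_coeff q C * ?v (atkin_lehner C))"
    by (simp add: intersection_number_alt Vinf_def Vinf_dot_component[OF q] flip: q_def)
  also have "\<dots> = (\<Sum>C\<in>UNIV. V0_coeff q (atkin_lehner C) * ?v (atkin_lehner C))
      - l * (\<Sum>C\<in>UNIV. fibre_multiplicity q C * ?v (atkin_lehner C))"
    unfolding Vinf_coeff_eq[OF q] l_def[symmetric]
    by (simp only: sum_distrib_left[of l] sum_subtractf left_diff_distrib mult.assoc)
  also have "\<dots> = (\<Sum>C\<in>UNIV. V0_coeff q C * ?v C)"
    using sum_atkin_lehner[of "\<lambda>C. V0_coeff q C * ?v C"] fib by simp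
  also have "\<dots> = intersection_number p (V0 p) (V0 p)"
    by (simp add: intersection_number_alt V0_def flip: q_def)
  finally show ?thesis .
qed

lemma intersection_number_V0_Vinf:
  fixes p :: nat
  assumes "p > 1"
  defines "q \<equiv> of_nat p"
  shows "intersection_number p (V0 p) (Vinf p) =
    (3 * q^7 + 5 * q^6 - 79 * q^5 + 3 * q^4 + 152 * q^3 + 500 * q^2 - 36 * q - 36) / (12 * (q^4 - q^2))"
proof -
  have q: "q > 1" using assms by simp
  have nz: "6 * (q^4 - q^2) \<noteq> 0" "12 * (q^4 - q^2) \<noteq> 0" using denominators_nonzero[OF q] by simp_all
  let ?v = "\<lambda>C. \<Sum>D\<in>UNIV. V0_coeff q D * component_intersection q C D"
  have "intersection_number p (V0 p) (Vinf p) = (\<Sum>C\<in>UNIV. V0_coeff q C * ?v (atkin_lehner C))"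
    by (simp add: intersection_number_alt V0_def Vinf_def Vinf_dot_component[OF q] flip: q_def)
  also have "\<dots> = (\<Sum>C\<in>UNIV. V0_numerator q C * ?v (atkin_lehner C)) / (6 * (q^4 - q^2))"
    unfolding V0_dot_component[OF q] by (simp add: V0_coeff_eq[OF q] sum_divide_distrib)
  also have "\<dots> = (3 * q^7 + 5 * q^6 - 79 * q^5 + 3 * q^4 + 152 * q^3 + 500 * q^2 - 36 * q - 36) / (12 * (q^4 - q^2))"
    unfolding V0_dot_component[OF q]
    by (rule divide_eq_divide[OF _ nz]) (unfold intersection_sum V0_numerator.simps atkin_lehner.simps, algebra)
  finally show ?thesis .
qed

section \<open>Asymptotics\<close>

lemma eventually_prime: "eventually prime primes_5_mod_12"
  by (simp add: primes_5_mod_12_def eventually_inf_principal)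

lemma tendsto_primes_5_mod_12: "(f \<longlongrightarrow> l) at_top \<Longrightarrow> (f \<longlongrightarrow> l) primes_5_mod_12"
  unfolding primes_5_mod_12_def by (rule tendsto_mono[OF inf_le1])

lemma genus_X0_prime_cube_asymptotics:
  "((\<lambda>p. genus_X0 (p^3) / real p ^ 3) \<longlongrightarrow> 1 / 12) primes_5_mod_12"
proof (rule LIM_zero_cancel, rule Lim_null_comparison)
  show "\<forall>\<^sub>F p in primes_5_mod_12. norm (genus_X0 (p^3) / real p ^ 3 - 1 / 12) \<le> 7 / real p"
    using eventually_prime
  proof eventually_elim
    case (elim p)
    then have p0: "real p > 0" by (simp add: prime_gt_0_nat)
    have "\<bar>genus_X0 (p^3) / real p ^ 3 - 1 / 12\<bar> = \<bar>genus_X0 (p^3) - real p ^ 3 / 12\<bar> / real p ^ 3"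
    proof -
      have "genus_X0 (p^3) / real p ^ 3 - 1 / 12 = (genus_X0 (p^3) - real p ^ 3 / 12) / real p ^ 3"
        using p0 by (simp add: diff_divide_distrib)
      then show ?thesis using p0 by simp
    qed
    also have "\<dots> \<le> 7 * real p ^ 2 / real p ^ 3"
      using genus_X0_prime_cube_bounds[OF elim] p0 by (intro divide_right_mono) auto
    also have "\<dots> = 7 / real p" using p0 by (simp add: field_simps power2_eq_square power3_eq_cube)
    finally show ?case by simp
  qed
  show "((\<lambda>p. 7 / real p) \<longlongrightarrow> 0) primes_5_mod_12"
    by (rule tendsto_primes_5_mod_12) real_asymp
qed

lemma V0_Vinf_asymptotics:
  "((\<lambda>p. real_of_rat (intersection_number p (V0 p) (Vinf p)) / real p ^ 3) \<longlongrightarrow> 1 / 4) primes_5_mod_12"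
proof (rule tendsto_primes_5_mod_12, rule Lim_transform_eventually)
  show "((\<lambda>p :: nat. (3 * real p^7 + 5 * real p^6 - 79 * real p^5 + 3 * real p^4 + 152 * real p^3 + 500 * real p^2
      - 36 * real p - 36) / (12 * (real p^4 - real p^2)) / real p ^ 3) \<longlongrightarrow> 1 / 4) at_top"
    by real_asymp
  show "\<forall>\<^sub>F p in at_top. (3 * real p^7 + 5 * real p^6 - 79 * real p^5 + 3 * real p^4 + 152 * real p^3 + 500 * real p^2
      - 36 * real p - 36) / (12 * (real p^4 - real p^2)) / real p ^ 3
      = real_of_rat (intersection_number p (V0 p) (Vinf p)) / real p ^ 3"
    using eventually_gt_at_top[of 1]
    by eventually_elim (simp add: intersection_number_V0_Vinf of_rat_divide of_rat_add of_rat_diff of_rat_mult of_rat_power)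
qed

lemma V0_V0_asymptotics:
  "((\<lambda>p. real_of_rat (intersection_number p (V0 p) (V0 p)) / real p ^ 3) \<longlongrightarrow> - (1 / 4)) primes_5_mod_12"
proof (rule tendsto_primes_5_mod_12, rule Lim_transform_eventually)
  show "((\<lambda>p :: nat. - (3 * real p^7 + 5 * real p^6 - 63 * real p^5 - 173 * real p^4 + 712 * real p^3 + 100 * real p^2
      - 36 * real p - 36) / (12 * (real p^4 - real p^2)) / real p ^ 3) \<longlongrightarrow> - (1 / 4)) at_top"
    by real_asymp
  show "\<forall>\<^sub>F p in at_top. - (3 * real p^7 + 5 * real p^6 - 63 * real p^5 - 173 * real p^4 + 712 * real p^3 + 100 * real p^2
      - 36 * real p - 36) / (12 * (real p^4 - real p^2)) / real p ^ 3
      = real_of_rat (intersection_number p (V0 p) (V0 p)) / real p ^ 3"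
    using eventually_gt_at_top[of 1]
    by eventually_elim (simp add: intersection_number_V0_V0 of_rat_divide of_rat_add of_rat_diff of_rat_mult of_rat_power of_rat_minus)
qed

theorem proposition4p4:
  shows "(\<lambda>p :: nat.
            1 / (genus_X0 (p^3) - 1) *
              (genus_X0 (p^3) * arakelov_pairing p (V0 p) (Vinf p)
               - (arakelov_pairing p (V0 p) (V0 p) + arakelov_pairing p (Vinf p) (Vinf p)) / 2)
            - 3 * genus_X0 (p^3) * ln (real p))
         \<in> o[primes_5_mod_12](\<lambda>p. genus_X0 (p^3) * ln (real p))"
proof -
  \<comment> \<open>All quantities are rescaled by $p^3$, so that each of them has a finite limit.\<close>
  define a where "a p = genus_X0 (p^3) / real p ^ 3" for p
  define i where "i p = real_of_rat (intersection_number p (V0 p) (Vinf p)) / real p ^ 3" for p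
  define s where "s p = real_of_rat (intersection_number p (V0 p) (V0 p)) / real p ^ 3" for p
  define e where "e p = 1 / real p ^ 3" for p :: nat
  have a: "(a \<longlongrightarrow> 1 / 12) primes_5_mod_12"
    unfolding a_def[abs_def] by (rule genus_X0_prime_cube_asymptotics)
  have i: "(i \<longlongrightarrow> 1 / 4) primes_5_mod_12" unfolding i_def[abs_def] by (rule V0_Vinf_asymptotics)
  have s: "(s \<longlongrightarrow> - (1 / 4)) primes_5_mod_12" unfolding s_def[abs_def] by (rule V0_V0_asymptotics)
  have e: "(e \<longlongrightarrow> 0) primes_5_mod_12"
    unfolding e_def[abs_def] by (rule tendsto_primes_5_mod_12) real_asymp
  have ae: "((\<lambda>p. a p - e p) \<longlongrightarrow> 1 / 12) primes_5_mod_12" using tendsto_diff[OF a e] by simp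
  have nz: "\<forall>\<^sub>F p in primes_5_mod_12. prime p \<and> a p \<noteq> 0 \<and> a p - e p \<noteq> 0"
  proof -
    have "\<forall>\<^sub>F p in primes_5_mod_12. a p \<noteq> 0" by (rule tendsto_imp_eventually_ne[OF a]) simp
    moreover have "\<forall>\<^sub>F p in primes_5_mod_12. a p - e p \<noteq> 0" by (rule tendsto_imp_eventually_ne[OF ae]) simp
    ultimately show ?thesis using eventually_prime by eventually_elim simp
  qed
  show ?thesis
  proof (rule smalloI_tendsto)
    have "((\<lambda>p. i p / (a p - e p) - s p * e p / ((a p - e p) * a p) - 3) \<longlongrightarrow>
        (1 / 4) / (1 / 12) - - (1 / 4) * 0 / (1 / 12 * (1 / 12)) - 3) primes_5_mod_12"
      by (intro tendsto_intros i s e a ae) auto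
    then have lim: "((\<lambda>p. i p / (a p - e p) - s p * e p / ((a p - e p) * a p) - 3) \<longlongrightarrow> 0) primes_5_mod_12"
      by simp
    show "((\<lambda>p. (1 / (genus_X0 (p^3) - 1) *
              (genus_X0 (p^3) * arakelov_pairing p (V0 p) (Vinf p)
               - (arakelov_pairing p (V0 p) (V0 p) + arakelov_pairing p (Vinf p) (Vinf p)) / 2)
            - 3 * genus_X0 (p^3) * ln (real p)) / (genus_X0 (p^3) * ln (real p))) \<longlongrightarrow> 0) primes_5_mod_12"
    proof (rule Lim_transform_eventually[OF lim])
      show "\<forall>\<^sub>F p in primes_5_mod_12. i p / (a p - e p) - s p * e p / ((a p - e p) * a p) - 3 =
        (1 / (genus_X0 (p^3) - 1) *
              (genus_X0 (p^3) * arakelov_pairing p (V0 p) (Vinf p)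
               - (arakelov_pairing p (V0 p) (V0 p) + arakelov_pairing p (Vinf p) (Vinf p)) / 2)
            - 3 * genus_X0 (p^3) * ln (real p)) / (genus_X0 (p^3) * ln (real p))"
        using nz
      proof eventually_elim
        case (elim p)
        define c where "c = real p ^ 3"
        define g I S L where "g = genus_X0 (p^3)" and "I = real_of_rat (intersection_number p (V0 p) (Vinf p))"
          and "S = real_of_rat (intersection_number p (V0 p) (V0 p))" and "L = ln (real p)"
        have p1: "p > 1" using elim prime_gt_1_nat by blast
        have c: "c \<noteq> 0" and L: "L \<noteq> 0" using p1 by (simp_all add: c_def L_def)
        have eqs: "a p = g / c" "i p = I / c" "s p = S / c" "e p = 1 / c"
          by (simp_all add: a_def i_def s_def e_def g_def I_def S_def c_def)
        have g: "g \<noteq> 0" "g - 1 \<noteq> 0" using elim c by (auto simp: eqs)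
        have ae: "a p - e p = (g - 1) / c" by (simp add: eqs diff_divide_distrib)
        \<comment> \<open>The factor $\log p$ cancels, which leaves a rational function of the rescaled quantities.\<close>
        have "i p / (a p - e p) - s p * e p / ((a p - e p) * a p) - 3
            = I / (g - 1) - S / ((g - 1) * g) - 3"
          unfolding ae unfolding eqs using c by simp
        also have "\<dots> = (1 / (g - 1) * (g * (I * L) - (S * L + S * L) / 2) - 3 * g * L) / (g * L)"
        proof -
          have "I / h - S / (h * g) - 3 = (1 / h * (g * (I * L) - (S * L + S * L) / 2) - 3 * g * L) / (g * L)"
            if "h \<noteq> 0" for h
            using that g(1) L by (simp add: field_simps)
          from this[OF g(2)] show ?thesis .
        qed
        finally show ?case
          using p1 by (simp add: arakelov_pairing_def intersection_number_Vinf_Vinf g_def I_def S_def L_def)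
      qed
    qed
    show "\<forall>\<^sub>F p in primes_5_mod_12. genus_X0 (p^3) * ln (real p) \<noteq> 0"
      using nz
    proof eventually_elim
      case (elim p)
      then show ?case using prime_gt_1_nat[of p] by (auto simp: a_def)
    qed
  qed
qed

end
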